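(* Let $\hat{\boldsymbol{x}}\in\mathbb{R}^n$ satisfy the GLICQ condition for the QCQP, and assume that $$d_{\mathcal{F}}(\hat{\boldsymbol{x}})<\left[1+\binom{n-1}{r-1}\right]^{-1}\frac{s(\hat{\boldsymbol{x}})}{2\|\boldsymbol{P}\|_2}.$$ Then, for all sufficiently large $\eta>0$, the penalized SDP with parameters $(\hat{\boldsymbol{x}},\eta,r)$ has a unique optimal solution $(\boldsymbol{x}^{\ast},\boldsymbol{X}^{\ast})$, it satisfies $\boldsymbol{X}^{\ast}=\boldsymbol{x}^{\ast}(\boldsymbol{x}^{\ast})^{\top}$, and $\boldsymbol{x}^{\ast}$ is feasible for the QCQP.
   Context: $\mathbb{S}_n$ is the set of $n\times n$ real symmetric matrices, $\langle\cdot,\cdot\rangle$ is the Frobenius inner product, and $\|\cdot\|_2$ is the Euclidean norm of vectors and the spectral norm of matrices. QCQP: let $\mathcal{I}$ and $\mathcal{E}$ be disjoint finite index sets. For each $k\in\{0\}\cup\mathcal{I}\cup\mathcal{E}$ let $q_k(\boldsymbol{x})=\boldsymbol{x}^{\top}\boldsymbol{A}_k\boldsymbol{x}+2\boldsymbol{b}_k^{\top}\boldsymbol{x}+c_k$ with $\boldsymbol{A}_k\in\mathbb{S}_n$, $\boldsymbol{b}_k\in\mathbb{R}^n$, $c_k\in\mathbb{R}$. The QCQP is: minimize $q_0(\boldsymbol{x})$ over $\boldsymbol{x}\in\mathbb{R}^n$ subject to $q_k(\boldsymbol{x})\le 0$ for $k\in\mathcal{I}$ and $q_k(\boldsymbol{x})=0$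 for $k\in\mathcal{E}$. Its feasible set is $\mathcal{F}$. Distance: $d_{\mathcal{F}}(\hat{\boldsymbol{x}})=\min\{\|\boldsymbol{x}-\hat{\boldsymbol{x}}\|_2: \boldsymbol{x}\in\mathcal{F}\}$ (this presupposes $\mathcal{F}\neq\emptyset$). GLICQ and sensitivity: the set of quasi-binding constraints at $\hat{\boldsymbol{x}}\in\mathbb{R}^n$ is $$\hat{\mathcal{B}}=\mathcal{E}\cup\Big\{k\in\mathcal{I}: q_k(\hat{\boldsymbol{x}})+\|\nabla q_k(\hat{\boldsymbol{x}})\|_2\,d_{\mathcal{F}}(\hat{\boldsymbol{x}})+\tfrac12\|\nabla^2q_k(\hat{\boldsymbol{x}})\|_2\,d_{\mathcal{F}}(\hat{\boldsymbol{x}})^2\ge0\Big\}.$$ Let $\mathcal{J}_{\hat{\mathcal{B}}}(\hat{\boldsymbol{x}})$ be the $|\hat{\mathcal{B}}|\times n$ matrix with rows $\nabla q_k(\hat{\boldsymbol{x}})^{\top}$, $k\in\hat{\mathcal{B}}$. The point $\hat{\boldsymbol{x}}$ satisfies the GLICQ condition if these rows are linearly independent. The sensitivity function is $s(\hat{\boldsymbol{x}})=\sigma_{\min}(\mathcal{J}_{\hat{\mathcal{B}}}(\hat{\boldsymbol{x}}))$ if $\hat{\boldsymbol{x}}$ satisfies GLICQ and $s(\hat{\boldsymbol{x}})=0$ otherwise, where $\sigma_{\min}$ is the smallest singular value, i.e. $\min\{\|\mathcal{J}_{\hat{\mathcal{B}}}(\hat{\boldsymbol{x}})^{\top}\boldsymbol{\nu}\|_2:\|\boldsymbol{\nu}\|_2=1\}$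 (read as $+\infty$ if $\hat{\mathcal{B}}=\emptyset$, in which case GLICQ holds vacuously). Pencil norm: for $(\boldsymbol{\gamma},\boldsymbol{\mu})\in\mathbb{R}^{|\mathcal{I}|}\times\mathbb{R}^{|\mathcal{E}|}$ let $\boldsymbol{P}(\boldsymbol{\gamma},\boldsymbol{\mu})=\sum_{k\in\mathcal{I}}\gamma_k\boldsymbol{A}_k+\sum_{k\in\mathcal{E}}\mu_k\boldsymbol{A}_k$ and $\|\boldsymbol{P}\|_2=\max\{\|\boldsymbol{P}(\boldsymbol{\gamma},\boldsymbol{\mu})\|_2:\|\boldsymbol{\gamma}\|_2^2+\|\boldsymbol{\mu}\|_2^2=1\}$. Penalized SDP: fix an integer $r$ with $2\le r\le n$ and let $\mathcal{C}_r\subseteq\mathbb{S}_n$ be the cone of matrices all of whose $r\times r$ principal submatrices are positive semidefinite. Let $\bar q_k(\boldsymbol{x},\boldsymbol{X})=\langle\boldsymbol{A}_k,\boldsymbol{X}\rangle+2\boldsymbol{b}_k^{\top}\boldsymbol{x}+c_k$. Given $\hat{\boldsymbol{x}}\in\mathbb{R}^n$ and $\eta>0$, the penalized SDP is: minimize $\bar q_0(\boldsymbol{x},\boldsymbol{X})+\eta\,(\mathrm{tr}\{\boldsymbol{X}\}-2\hat{\boldsymbol{x}}^{\top}\boldsymbol{x}+\hat{\boldsymbol{x}}^{\top}\hat{\boldsymbol{x}})$ over $(\boldsymbol{x},\boldsymbol{X})\in\mathbb{R}^n\times\mathbb{S}_n$ subject to $\bar q_k(\boldsymbol{x},\boldsymbol{X})\le0$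 for $k\in\mathcal{I}$, $\bar q_k(\boldsymbol{x},\boldsymbol{X})=0$ for $k\in\mathcal{E}$, and $\boldsymbol{X}-\boldsymbol{x}\boldsymbol{x}^{\top}\in\mathcal{C}_r$. "For all sufficiently large $\eta$" means: there is $\eta_0$ such that the assertion holds for every $\eta\ge\eta_0$. *)

theory Defs
  imports "HOL-Analysis.Analysis"
begin

section \<open>Matrices\<close>

definition sym_mat :: "real^'n^'n \<Rightarrow> bool" where
  "sym_mat M \<longleftrightarrow> transpose M = M"

text \<open>The library's \<open>norm\<close> on \<open>real^'n^'n\<close> is the Frobenius norm (and \<open>\<bullet>\<close> the Frobenius inner
  product), so the spectral norm has to be taken as an operator norm.\<close>

definition spectral_norm :: "real^'n^'n \<Rightarrow> real" where
  "spectral_norm M = onorm ((*v) M)"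

definition outer :: "real^'n \<Rightarrow> real^'n \<Rightarrow> real^'n^'n" where
  "outer x y = (\<chi> i j. x$i * y$j)"

text \<open>The principal submatrix of \<open>M\<close> with rows and columns \<open>S\<close> is positive semidefinite. Since its
  size is not a type, its quadratic form is written out as a sum over \<open>S\<close>.\<close>

definition psd_principal :: "'n set \<Rightarrow> real^'n^'n \<Rightarrow> bool" where
  "psd_principal S M \<longleftrightarrow> (\<forall>v :: 'n \<Rightarrow> real. 0 \<le> (\<Sum>i\<in>S. \<Sum>j\<in>S. v i * M$i$j * v j))"

definition psd_cone :: "nat \<Rightarrow> (real^'n^'n) set" where
  "psd_cone r = {M. sym_mat M \<and> (\<forall>S. card S = r \<longrightarrow> psd_principal S M)}"

section \<open>Gradient and Hessian\<close>

definition gradient :: "(real^'n \<Rightarrow> real) \<Rightarrow> real^'n \<Rightarrow> real^'n" where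
  "gradient f x = (THE D. GDERIV f x :> D)"

definition hessian :: "(real^'n \<Rightarrow> real) \<Rightarrow> real^'n \<Rightarrow> real^'n^'n" where
  "hessian f x = jacobian (gradient f) (at x)"

lemma gradient_eqI:
  assumes "GDERIV f x :> D"
  shows "gradient f x = D"
  unfolding gradient_def
proof (rule the_equality)
  show "GDERIV f x :> D" by fact
next
  fix D' assume "GDERIV f x :> D'"
  then have "(\<lambda>h. h \<bullet> D') = (\<lambda>h. h \<bullet> D)"
    using assms unfolding gderiv_def by (rule has_derivative_unique)
  then show "D' = D"
    by (metis vector_eq_ldot)
qed

section \<open>Quadratically constrained programs\<close>

definition quad :: "real^'n^'n \<Rightarrow> real^'n \<Rightarrow> real \<Rightarrow> real^'n \<Rightarrow> real" where
  "quad M v \<alpha> x = x \<bullet> (M *v x) + 2 * (v \<bullet> x) + \<alpha>"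

lemma GDERIV_quad:
  assumes "sym_mat M"
  shows "GDERIV (quad M v \<alpha>) x :> 2 *\<^sub>R (M *v x + v)"
proof -
  have sym: "x \<bullet> (M *v h) = h \<bullet> (M *v x)" for h
    using assms unfolding sym_mat_def
    by (metis dot_lmul_matrix inner_commute vector_transpose_matrix)
  have mv: "((\<lambda>y. M *v y) has_derivative (\<lambda>h. M *v h)) (at x)"
    by (rule bounded_linear_imp_has_derivative) (rule matrix_vector_mul_bounded_linear)
  have "((\<lambda>y. y \<bullet> (M *v y) + 2 * (v \<bullet> y) + \<alpha>) has_derivative
         (\<lambda>h. x \<bullet> (M *v h) + h \<bullet> (M *v x) + 2 * (v \<bullet> h))) (at x)"
    by (auto intro!: derivative_eq_intros mv)
  moreover have "(\<lambda>h. x \<bullet> (M *v h) + h \<bullet> (M *v x) + 2 * (v \<bullet> h))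
      = (\<lambda>h. h \<bullet> (2 *\<^sub>R (M *v x + v)))"
    by (simp add: sym inner_add_right inner_commute fun_eq_iff algebra_simps)
  ultimately show ?thesis
    unfolding gderiv_def quad_def by simp
qed

lemma gradient_quad: "sym_mat M \<Longrightarrow> gradient (quad M v \<alpha>) x = 2 *\<^sub>R (M *v x + v)"
  by (rule gradient_eqI) (rule GDERIV_quad)

lemma hessian_quad:
  assumes "sym_mat M"
  shows "hessian (quad M v \<alpha>) x = 2 *\<^sub>R M"
proof -
  have "gradient (quad M v \<alpha>) = (\<lambda>y. 2 *\<^sub>R (M *v y + v))"
    using gradient_quad[OF assms] by blast
  moreover have "((\<lambda>y. M *v y) has_derivative (\<lambda>h. M *v h)) (at x)"
    by (rule bounded_linear_imp_has_derivative) (rule matrix_vector_mul_bounded_linear)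
  then have "((\<lambda>y. 2 *\<^sub>R (M *v y + v)) has_derivative (\<lambda>h. 2 *\<^sub>R (M *v h))) (at x)"
    by (auto intro!: derivative_eq_intros)
  ultimately have "frechet_derivative (gradient (quad M v \<alpha>)) (at x) = (\<lambda>h. 2 *\<^sub>R (M *v h))"
    using frechet_derivative_at[symmetric] by simp
  also have "\<dots> = (*v) (2 *\<^sub>R M)"
    by (simp add: fun_eq_iff scaleR_matrix_vector_assoc)
  finally show ?thesis
    by (simp add: hessian_def jacobian_def)
qed

text \<open>Below, \<open>q\<close> is the family of constraint functions, \<open>I\<close> indexes the inequality and \<open>E\<close> the
  equality constraints.\<close>

definition qcqp_feasible :: "'k set \<Rightarrow> 'k set \<Rightarrow> ('k \<Rightarrow> real^'n \<Rightarrow> real) \<Rightarrow> (real^'n) set" where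
  "qcqp_feasible I E q = {x. (\<forall>k\<in>I. q k x \<le> 0) \<and> (\<forall>k\<in>E. q k x = 0)}"

definition quasi_binding ::
  "'k set \<Rightarrow> 'k set \<Rightarrow> ('k \<Rightarrow> real^'n \<Rightarrow> real) \<Rightarrow> real^'n \<Rightarrow> 'k set" where
  "quasi_binding I E q x =
     (let d = infdist x (qcqp_feasible I E q) in
      E \<union> {k\<in>I. q k x + norm (gradient (q k) x) * d
                  + 1/2 * spectral_norm (hessian (q k) x) * d\<^sup>2 \<ge> 0})"

text \<open>Injectivity is needed because equal gradients of distinct constraints count as linearly
  dependent rows.\<close>

definition GLICQ :: "'k set \<Rightarrow> 'k set \<Rightarrow> ('k \<Rightarrow> real^'n \<Rightarrow> real) \<Rightarrow> real^'n \<Rightarrow> bool" where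
  "GLICQ I E q x \<longleftrightarrow>
     (let g = (\<lambda>k. gradient (q k) x); B = quasi_binding I E q x in
      inj_on g B \<and> independent (g ` B))"

text \<open>Smallest singular value \<open>min {\<parallel>J\<^sup>T \<nu>\<parallel> : \<parallel>\<nu>\<parallel> = 1}\<close> of the matrix \<open>J\<close> whose rows are \<open>g k\<close> for
  \<open>k \<in> B\<close>. In \<open>ennreal\<close> the infimum over the empty set is \<open>\<infinity>\<close>, which is the value for \<open>B = {}\<close>.\<close>

definition sigma_min :: "'k set \<Rightarrow> ('k \<Rightarrow> real^'n) \<Rightarrow> ennreal" where
  "sigma_min B g = (INF \<nu>\<in>{\<nu> :: 'k \<Rightarrow> real. L2_set \<nu> B = 1}. ennreal (norm (\<Sum>k\<in>B. \<nu> k *\<^sub>R g k)))"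

definition sensitivity ::
  "'k set \<Rightarrow> 'k set \<Rightarrow> ('k \<Rightarrow> real^'n \<Rightarrow> real) \<Rightarrow> real^'n \<Rightarrow> ennreal" where
  "sensitivity I E q x =
     (if GLICQ I E q x then sigma_min (quasi_binding I E q x) (\<lambda>k. gradient (q k) x) else 0)"

definition pencil ::
  "'k set \<Rightarrow> 'k set \<Rightarrow> ('k \<Rightarrow> real^'n^'n) \<Rightarrow> ('k \<Rightarrow> real) \<Rightarrow> ('k \<Rightarrow> real) \<Rightarrow> real^'n^'n" where
  "pencil I E A \<gamma> \<mu> = (\<Sum>k\<in>I. \<gamma> k *\<^sub>R A k) + (\<Sum>k\<in>E. \<mu> k *\<^sub>R A k)"

text \<open>In \<open>ennreal\<close> the supremum over the empty set is \<open>0\<close>, the natural value without constraints.\<close>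

definition pencil_norm :: "'k set \<Rightarrow> 'k set \<Rightarrow> ('k \<Rightarrow> real^'n^'n) \<Rightarrow> ennreal" where
  "pencil_norm I E A =
     (SUP (\<gamma>, \<mu>)\<in>{(\<gamma>, \<mu>). (L2_set \<gamma> I)\<^sup>2 + (L2_set \<mu> E)\<^sup>2 = 1}.
        ennreal (spectral_norm (pencil I E A \<gamma> \<mu>)))"

section \<open>The penalized semidefinite relaxation\<close>

definition lifted_quad ::
  "real^'n^'n \<Rightarrow> real^'n \<Rightarrow> real \<Rightarrow> real^'n \<Rightarrow> real^'n^'n \<Rightarrow> real" where
  "lifted_quad M v \<alpha> x X = M \<bullet> X + 2 * (v \<bullet> x) + \<alpha>"

text \<open>Here \<open>qb\<close> is the family of lifted constraint functions.\<close>

definition psdp_feasible ::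
  "nat \<Rightarrow> 'k set \<Rightarrow> 'k set \<Rightarrow> ('k \<Rightarrow> real^'n \<Rightarrow> real^'n^'n \<Rightarrow> real)
     \<Rightarrow> ((real^'n) \<times> (real^'n^'n)) set" where
  "psdp_feasible r I E qb = {(x, X). sym_mat X \<and> (\<forall>k\<in>I. qb k x X \<le> 0) \<and> (\<forall>k\<in>E. qb k x X = 0)
     \<and> X - outer x x \<in> psd_cone r}"

definition psdp_objective ::
  "(real^'n \<Rightarrow> real^'n^'n \<Rightarrow> real) \<Rightarrow> real^'n \<Rightarrow> real \<Rightarrow> (real^'n) \<times> (real^'n^'n) \<Rightarrow> real" where
  "psdp_objective qb0 xh \<eta> = (\<lambda>(x, X).
     qb0 x X + \<eta> * (trace X - 2 * (xh \<bullet> x) + xh \<bullet> xh))"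

definition psdp_optimal ::
  "nat \<Rightarrow> 'k set \<Rightarrow> 'k set \<Rightarrow> (real^'n \<Rightarrow> real^'n^'n \<Rightarrow> real)
     \<Rightarrow> ('k \<Rightarrow> real^'n \<Rightarrow> real^'n^'n \<Rightarrow> real)
     \<Rightarrow> real^'n \<Rightarrow> real \<Rightarrow> (real^'n) \<times> (real^'n^'n) \<Rightarrow> bool" where
  "psdp_optimal r I E qb0 qb xh \<eta> z \<longleftrightarrow>
     is_arg_min (psdp_objective qb0 xh \<eta>) (\<lambda>w. w \<in> psdp_feasible r I E qb) z"

end

theory Submission
  imports Defs
begin

text \<open>Let \<open>d\<close> be the distance of \<open>xh\<close> to the feasible set and let \<open>s\<close>, \<open>P\<close> be the sensitivity and the pencil
  norm. Minimising \<open>q\<^sub>0(x) + \<eta> \<parallel>x - xh\<parallel>\<^sup>2\<close> over the feasible set for large \<open>\<eta>\<close> gives a point \<open>x\<close> whose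
  distance to \<open>xh\<close> is barely larger than \<open>d\<close>. There only quasi-binding constraints can be active,
  and their Jacobian has smallest singular value at least about \<open>s - 2 P d > 0\<close>, so Lagrange multipliers
  \<open>\<nu>\<close> exist and satisfy \<open>\<parallel>\<nu>\<parallel> / \<eta> \<le> 2 d / (s - 2 P d)\<close> up to \<open>o(1)\<close>. With \<open>N = (n - 1 choose r - 1)\<close> the
  hypothesis on \<open>d\<close> then says that \<open>H = A\<^sub>0 + \<Sum> \<nu>\<^sub>k A\<^sub>k\<close> satisfies \<open>N \<parallel>H\<parallel>\<^sub>2 < \<eta>\<close>. Since
  \<open>\<langle>H, Y\<rangle> \<ge> - N \<parallel>H\<parallel>\<^sub>2 tr Y\<close> for \<open>Y\<close> in the cone, \<open>Z = \<eta> 1 + H\<close> is positive on nonzero elements of the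
  cone, and the Lagrangian of the penalized program exceeds its value at \<open>(x, x x\<^sup>T)\<close> by
  \<open>\<langle>Z, X - y y\<^sup>T\<rangle> + (y - x)\<^sup>T Z (y - x)\<close> at \<open>(y, X)\<close>.\<close>

section \<open>Inner products with matrices in the cone\<close>

text \<open>For \<open>a > 0\<close> the form at \<open>(b, - a)\<close> equals
  \<open>a * (a * c - b\<^sup>2)\<close>. For \<open>a = 0\<close> and \<open>b \<noteq> 0\<close>
  it is linear in \<open>s\<close> at \<open>t = 1\<close> and takes the value -1 somewhere.\<close>

lemma quad_nonneg_imp_discriminant:
  fixes a b c :: real
  assumes "\<And>s t. 0 \<le> a * s\<^sup>2 + 2 * b * s * t + c * t\<^sup>2"
  shows "b\<^sup>2 \<le> a * c"
proof (cases "a = 0")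
  case True
  have "b = 0"
  proof (rule ccontr)
    assume "b \<noteq> 0"
    then show False using assms[of "- (c + 1) / (2 * b)" 1] True by simp
  qed
  then show ?thesis using True by simp
next
  case False
  then have "a > 0" using assms[of 1 0] by simp
  have "0 \<le> a * (a * c - b\<^sup>2)"
    using assms[of b "- a"] by (simp add: power2_eq_square algebra_simps)
  then show ?thesis using \<open>a > 0\<close> by (simp add: zero_le_mult_iff)
qed

lemma inner_matrix_sum: "(M :: real^'n^'m) \<bullet> X = (\<Sum>i\<in>UNIV. \<Sum>j\<in>UNIV. M$i$j * X$i$j)"
  by (simp add: inner_vec_def)

lemma norm_matrix_power2: "(norm (M :: real^'n^'m))\<^sup>2 = (\<Sum>i\<in>UNIV. \<Sum>j\<in>UNIV. (M$i$j)\<^sup>2)"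
proof -
  have "(norm M)\<^sup>2 = M \<bullet> M" by (rule power2_norm_eq_inner)
  then show ?thesis by (simp only: inner_matrix_sum power2_eq_square)
qed

lemma inner_outer: "M \<bullet> outer x y = x \<bullet> (M *v y)"
  by (simp add: inner_vec_def outer_def matrix_vector_mult_def sum_distrib_left mult_ac)

lemma mat_1_inner: "(mat 1 :: real^'n^'n) \<bullet> X = trace X"
  by (simp add: inner_matrix_sum mat_def trace_def if_distrib[of "\<lambda>z. z * _"] sum.delta cong: if_cong)

lemma sym_mat_form_commute:
  assumes "sym_mat M"
  shows "x \<bullet> (M *v y) = y \<bullet> (M *v x)"
  using assms unfolding sym_mat_def
  by (metis dot_lmul_matrix inner_commute vector_transpose_matrix)

lemma psd_principal_UNIV: "psd_principal UNIV M \<longleftrightarrow> (\<forall>x. 0 \<le> x \<bullet> (M *v x))"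
proof -
  have eq: "(\<Sum>i\<in>UNIV. \<Sum>j\<in>UNIV. v i * M$i$j * v j) = (\<chi> i. v i) \<bullet> (M *v (\<chi> i. v i))" for v :: "'a \<Rightarrow> real"
    by (simp add: inner_vec_def matrix_vector_mult_def sum_distrib_left mult_ac)
  show ?thesis
  proof
    assume "psd_principal UNIV M"
    then have "0 \<le> (\<chi> i. x $ i) \<bullet> (M *v (\<chi> i. x $ i))" for x
      unfolding psd_principal_def eq[symmetric] by blast
    then show "\<forall>x. 0 \<le> x \<bullet> (M *v x)" by simp
  qed (auto simp: psd_principal_def eq)
qed

text \<open>A test vector supported on the two indices \<open>i\<close> and \<open>j\<close> reduces
  the form on \<open>S\<close> to a binary one.\<close>

lemma psd_principal_2x2:
  assumes sym: "sym_mat Y" and psd: "psd_principal S Y" and S: "finite S" "i \<in> S" "j \<in> S" "i \<noteq> j"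
  shows "0 \<le> Y$i$i * s\<^sup>2 + 2 * Y$i$j * s * t + Y$j$j * t\<^sup>2"
proof -
  define v where "v k = (if k = i then s else if k = j then t else 0)" for k
  have sij: "Y$j$i = Y$i$j" using sym unfolding sym_mat_def transpose_def
    by (metis vec_lambda_beta)
  have *: "(\<Sum>k\<in>S. h k * v k) = h i * s + h j * t" for h
  proof -
    have "(\<Sum>k\<in>S. h k * v k) = (\<Sum>k\<in>{i,j}. h k * v k)"
      using S by (intro sum.mono_neutral_right) (auto simp: v_def)
    then show ?thesis using S by (simp add: v_def)
  qed
  have **: "(\<Sum>k\<in>S. v k * h k) = h i * s + h j * t" for h
    using *[of h] by (simp add: mult.commute)
  have "0 \<le> (\<Sum>k\<in>S. \<Sum>l\<in>S. v k * Y$k$l * v l)"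
    using psd unfolding psd_principal_def by blast
  also have "\<dots> = (\<Sum>k\<in>S. v k * (Y$k$i * s + Y$k$j * t))"
    using *[of "\<lambda>l. v _ * Y$_$l"] by (simp add: algebra_simps)
  also have "\<dots> = Y$i$i * s\<^sup>2 + 2 * Y$i$j * s * t + Y$j$j * t\<^sup>2"
    unfolding ** by (simp add: sij power2_eq_square algebra_simps)
  finally show ?thesis .
qed

text \<open>Since \<open>2 \<le> r \<le> CARD('n)\<close>, any two indices lie in a common set of
  size \<open>r\<close>, so all 2 x 2 minors of \<open>Y\<close> are nonnegative, whatever
  \<open>r\<close> is.\<close>

lemma psd_cone_minor:
  fixes Y :: "real^'n^'n"
  assumes Y: "Y \<in> psd_cone r" and r: "2 \<le> r" "r \<le> CARD('n)"
  shows "0 \<le> Y$i$i" "(Y$i$j)\<^sup>2 \<le> Y$i$i * Y$j$j"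
proof -
  have ex: "\<exists>S. card S = r \<and> i \<in> S \<and> j \<in> S" for i j :: 'n
  proof -
    have "card {i, j} \<le> r" using r card_insert_le_m1[of 2 "{j}" i] by (simp add: card_insert_if)
    then show ?thesis using exists_subset_between[of "{i,j}" r UNIV] r by auto
  qed
  have ne: "0 \<le> Y$i$i * s\<^sup>2 + 2 * Y$i$j * s * t + Y$j$j * t\<^sup>2" if "i \<noteq> j" for i j s t
    using ex[of i j] psd_principal_2x2[of Y _ i j s t] Y that unfolding psd_cone_def by auto
  show nn: "0 \<le> Y$i$i" for i
  proof -
    \<comment> \<open>The binary form needs two distinct indices, so a companion \<open>j\<close>
      for \<open>i\<close> is chosen first.\<close>
    have "card {i} < CARD('n)" using r by simp
    then obtain j where "j \<noteq> i"
      by (metis UNIV_eq_I card.empty card_insert_disjoint finite.emptyI insert_iff less_irrefl)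
    then show ?thesis using ne[of i j 1 0] by simp
  qed
  show "(Y$i$j)\<^sup>2 \<le> Y$i$i * Y$j$j"
  proof (cases "i = j")
    case False
    then show ?thesis using quad_nonneg_imp_discriminant[OF ne] by blast
  qed (simp add: power2_eq_square)
qed

lemma norm_psd_cone_le_trace:
  fixes Y :: "real^'n^'n"
  assumes Y: "Y \<in> psd_cone r" and r: "2 \<le> r" "r \<le> CARD('n)"
  shows "norm Y \<le> trace Y"
proof (rule power2_le_imp_le)
  have "(norm Y)\<^sup>2 = (\<Sum>i\<in>UNIV. \<Sum>j\<in>UNIV. (Y$i$j)\<^sup>2)"
    by (rule norm_matrix_power2)
  also have "\<dots> \<le> (\<Sum>i\<in>UNIV. \<Sum>j\<in>UNIV. Y$i$i * Y$j$j)"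
    by (intro sum_mono psd_cone_minor[OF assms])
  also have "\<dots> = (trace Y)\<^sup>2"
    by (simp add: trace_def power2_eq_square sum_product)
  finally show "(norm Y)\<^sup>2 \<le> (trace Y)\<^sup>2" .
  show "0 \<le> trace Y"
    unfolding trace_def by (intro sum_nonneg psd_cone_minor[OF assms])
qed

lemma norm_matrix_vector_le_spectral: "norm (M *v x) \<le> spectral_norm M * norm x"
  unfolding spectral_norm_def by (rule onorm) (rule matrix_vector_mul_bounded_linear)

lemma spectral_norm_nonneg: "0 \<le> spectral_norm M"
  unfolding spectral_norm_def by (rule onorm_pos_le) (rule matrix_vector_mul_bounded_linear)

lemma abs_quadratic_form_le: "\<bar>x \<bullet> (M *v x)\<bar> \<le> spectral_norm M * (norm x)\<^sup>2"
proof -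
  have "\<bar>x \<bullet> (M *v x)\<bar> \<le> norm x * norm (M *v x)" by (rule Cauchy_Schwarz_ineq2)
  also have "\<dots> \<le> norm x * (spectral_norm M * norm x)"
    by (intro mult_left_mono norm_matrix_vector_le_spectral) simp
  finally show ?thesis by (simp add: power2_eq_square mult_ac)
qed

text \<open>The squared Frobenius norm is the sum of the squared lengths of the columns
  \<open>M *v axis j 1\<close>, each of which is at most the squared spectral norm.\<close>

lemma norm_le_sqrt_card_spectral:
  fixes M :: "real^'n^'n"
  shows "norm M \<le> sqrt (CARD('n)) * spectral_norm M"
proof (rule power2_le_imp_le)
  have "(norm M)\<^sup>2 = (\<Sum>i\<in>UNIV. \<Sum>j\<in>UNIV. (M$i$j)\<^sup>2)"
    by (rule norm_matrix_power2)
  also have "\<dots> = (\<Sum>j\<in>UNIV. \<Sum>i\<in>UNIV. (M$i$j)\<^sup>2)" by (rule sum.swap)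
  also have "\<dots> = (\<Sum>j\<in>UNIV. (norm (M *v axis j 1))\<^sup>2)"
    by (simp add: power2_norm_eq_inner inner_vec_def matrix_vector_mult_basis column_def flip: power2_eq_square)
  also have "\<dots> \<le> (\<Sum>j\<in>(UNIV::'n set). (spectral_norm M)\<^sup>2)"
    using norm_matrix_vector_le_spectral[of M "axis _ 1"]
    by (intro sum_mono power_mono) (simp_all add: norm_axis_1)
  finally show "(norm M)\<^sup>2 \<le> (sqrt CARD('n) * spectral_norm M)\<^sup>2"
    by (simp add: power_mult_distrib)
qed (simp add: spectral_norm_nonneg)

text \<open>In Pascal's rule one summand is at least \<open>m\<close> by induction and the other at
  least 1.\<close>

lemma binomial_ge_base:
  fixes m t :: nat
  assumes "1 \<le> t" "t < m"
  shows "m \<le> m choose t"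
  using assms
proof (induction m arbitrary: t)
  case (Suc m)
  obtain u where t: "t = Suc u" using Suc.prems by (cases t) auto
  show ?case
  proof (cases "t = m")
    case False
    then have "m \<le> m choose t" "1 \<le> m choose u"
      using Suc t by (auto simp: Suc_le_eq)
    then show ?thesis using t by simp
  qed simp
qed simp

text \<open>Symmetric elimination writes \<open>Y\<close> as a nonnegative combination of matrices
  \<open>outer u u\<close>, and \<open>M\<close> pairs with each of them to
  \<open>u \<bullet> (M *v u) \<ge> 0\<close>. The induction runs over a set \<open>S\<close>
  outside of which all rows of \<open>Y\<close> vanish.\<close>

lemma psd_inner_nonneg:
  fixes Y M :: "real^'n^'n"
  assumes M: "\<And>x. 0 \<le> x \<bullet> (M *v x)"
    and "sym_mat Y" "\<And>x. 0 \<le> x \<bullet> (Y *v x)"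
    and "finite S" "\<And>i j. i \<notin> S \<Longrightarrow> Y$i$j = 0"
  shows "0 \<le> M \<bullet> Y"
  using assms(4,2,3,5)
proof (induction S arbitrary: Y)
  case empty
  then show ?case by (simp add: inner_matrix_sum)
next
  case (insert a S)
  have sym: "Y$i$j = Y$j$i" for i j
    using insert.prems(1) unfolding sym_mat_def transpose_def by (metis vec_lambda_beta)
  define u where "u = column a Y"
  have ax: "Y *v axis a 1 = u" by (simp add: u_def matrix_vector_mult_basis)
  \<comment> \<open>This is Cauchy-Schwarz for the semidefinite form \<open>Y\<close> with the
    vectors \<open>axis a 1\<close> and \<open>x\<close>. It keeps the matrix semidefinite after the
    elimination step and forces \<open>u = 0\<close> when the pivot is zero.\<close>
  have disc: "(u \<bullet> x)\<^sup>2 \<le> Y$a$a * (x \<bullet> (Y *v x))" for x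
  proof (rule quad_nonneg_imp_discriminant)
    fix s t
    have "axis a 1 \<bullet> (Y *v axis a 1) = Y$a$a"
      by (simp add: ax inner_axis' u_def column_def)
    moreover have "axis a 1 \<bullet> (Y *v x) = u \<bullet> x" using sym_mat_form_commute[OF insert.prems(1), of "axis a 1" x] ax by (simp add: inner_commute)
    moreover have "x \<bullet> (Y *v axis a 1) = u \<bullet> x" using ax by (simp add: inner_commute)
    moreover have "0 \<le> (s *\<^sub>R axis a 1 + t *\<^sub>R x) \<bullet> (Y *v (s *\<^sub>R axis a 1 + t *\<^sub>R x))"
      by (rule insert.prems(2))
    ultimately show "0 \<le> Y$a$a * s\<^sup>2 + 2 * (u \<bullet> x) * s * t + (x \<bullet> (Y *v x)) * t\<^sup>2"
      by (simp add: matrix_vector_right_distrib matrix_vector_mult_scaleR inner_add_left inner_add_right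
          power2_eq_square algebra_simps)
  qed
  \<comment> \<open>One Cholesky step: subtracting the rank-one matrix \<open>u u\<^sup>T / Y$a$a\<close> clears row \<open>a\<close>.\<close>
  show ?case
  proof (cases "Y$a$a = 0")
    case True
    have "u \<bullet> x = 0" for x using disc[of x] True by simp
    then have "u = 0" using inner_eq_zero_iff by blast
    then have "Y$a$j = 0" for j
      using sym[of a j] unfolding u_def column_def vec_eq_iff by simp
    then have "\<And>i j. i \<notin> S \<Longrightarrow> Y$i$j = 0" using insert.prems(3) by (metis insert_iff)
    then show ?thesis using insert.IH insert.prems by blast
  next
    case False
    have pos: "Y$a$a > 0" using insert.prems(2)[of "axis a 1"] False
      by (simp add: ax inner_axis' u_def column_def)
    define W where "W = Y - (1 / Y$a$a) *\<^sub>R outer u u"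
    have "0 \<le> M \<bullet> W"
    proof (rule insert.IH)
      show "sym_mat W" using sym unfolding sym_mat_def W_def
        by (simp add: vec_eq_iff transpose_def outer_def mult.commute)
      show "0 \<le> x \<bullet> (W *v x)" for x
      proof -
        have "x \<bullet> (W *v x) = W \<bullet> outer x x" by (simp add: inner_outer)
        also have "\<dots> = Y \<bullet> outer x x - (1 / Y$a$a) * (outer u u \<bullet> outer x x)"
          by (simp add: W_def inner_diff_left)
        also have "Y \<bullet> outer x x = x \<bullet> (Y *v x)" by (rule inner_outer)
        also have "outer u u \<bullet> outer x x = (u \<bullet> x)\<^sup>2"
          by (simp add: inner_matrix_sum outer_def inner_vec_def power2_eq_square sum_product mult_ac)
        finally have "x \<bullet> (W *v x) = x \<bullet> (Y *v x) - (u \<bullet> x)\<^sup>2 / Y$a$a" by simp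
        moreover have "(u \<bullet> x)\<^sup>2 / Y$a$a \<le> x \<bullet> (Y *v x)"
          using disc[of x] pos by (simp add: pos_divide_le_eq mult.commute)
        ultimately show ?thesis by simp
      qed
      show "W$i$j = 0" if "i \<notin> S" for i j
      proof (cases "i = a")
        case True
        then show ?thesis using pos sym[of a j] by (simp add: W_def outer_def u_def column_def)
      next
        case False
        then have "Y$i$k = 0" for k using that insert.prems(3) by blast
        then show ?thesis by (simp add: W_def outer_def u_def column_def)
      qed
    qed
    moreover have "0 \<le> (1 / Y$a$a) * (u \<bullet> (M *v u))" using M pos by simp
    moreover have "M \<bullet> Y = M \<bullet> W + (1 / Y$a$a) * (u \<bullet> (M *v u))"
      by (simp add: W_def inner_diff_right inner_outer)
    ultimately show ?thesis by simp
  qed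
qed

lemma psd_cone_inner_ge:
  fixes H Y :: "real^'n^'n"
  assumes Y: "Y \<in> psd_cone r" and r: "2 \<le> r" "r \<le> CARD('n)"
  shows "- (real ((CARD('n) - 1) choose (r - 1)) * spectral_norm H * trace Y) \<le> H \<bullet> Y"
proof (cases "r = CARD('n)")
  case True
  \<comment> \<open>For \<open>r = CARD('n)\<close> the binomial coefficient is 1 and the cone is
    that of all semidefinite matrices. Shifting \<open>H\<close> by its spectral norm makes its form
    nonnegative.\<close>
  define M where "M = spectral_norm H *\<^sub>R mat 1 + H"
  have "0 \<le> M \<bullet> Y"
  proof (rule psd_inner_nonneg)
    show "0 \<le> x \<bullet> (M *v x)" for x
      using abs_quadratic_form_le[of x H]
      by (simp add: M_def matrix_vector_mult_add_rdistrib inner_add_right power2_norm_eq_inner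
          flip: scaleR_matrix_vector_assoc)
    show "0 \<le> x \<bullet> (Y *v x)" for x
      using Y True psd_principal_UNIV[of Y] by (simp add: psd_cone_def)
    show "sym_mat Y" using Y by (simp add: psd_cone_def)
  qed (auto intro: finite)
  then show ?thesis using True
    by (simp add: M_def inner_add_left mat_1_inner)
next
  case False
  \<comment> \<open>Only the \<open>2 \<times> 2\<close> minors are needed, through \<open>\<parallel>Y\<parallel> \<le> tr Y\<close>, because now \<open>\<surd>n \<le> n - 1 \<le> (n - 1 choose r - 1)\<close>.\<close>
  define n where "n = CARD('n)"
  have n: "3 \<le> n" "n - 1 \<le> (n - 1) choose (r - 1)"
    using r False binomial_ge_base[of "r - 1" "n - 1"] by (auto simp: n_def)
  have tr: "norm Y \<le> trace Y" by (rule norm_psd_cone_le_trace[OF assms])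
  have "real n \<le> (real (n - 1))\<^sup>2"
  proof -
    obtain m where "n = m + 3" using n(1) by (metis le_add_diff_inverse add.commute)
    then show ?thesis by (simp add: power2_eq_square algebra_simps)
  qed
  then have "sqrt n \<le> real (n - 1)" by (rule real_le_lsqrt[rotated]) simp
  then have sq: "sqrt n \<le> real ((n - 1) choose (r - 1))" using n(2) by linarith
  have "- (H \<bullet> Y) \<le> norm H * norm Y" using Cauchy_Schwarz_ineq2[of H Y] by linarith
  also have "\<dots> \<le> (sqrt n * spectral_norm H) * trace Y"
    using norm_le_sqrt_card_spectral[of H] tr spectral_norm_nonneg[of H] unfolding n_def
    by (intro mult_mono) auto
  also have "\<dots> \<le> (real ((n - 1) choose (r - 1)) * spectral_norm H) * trace Y"
    using sq order_trans[OF norm_ge_zero tr] spectral_norm_nonneg[of H]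
    by (intro mult_right_mono)
  finally show ?thesis unfolding n_def by linarith
qed

section \<open>Lagrange multipliers by quadratic penalties\<close>

text \<open>Squaring removes the kink of the positive part: at 0 the difference quotient is
  \<open>max 0 h\<close>. Hence the quadratic penalty for inequalities is differentiable.\<close>

lemma DERIV_max_0_power2: "((\<lambda>u. (max 0 u)\<^sup>2) has_real_derivative 2 * max 0 u) (at (u::real))"
proof (cases u "0::real" rule: linorder_cases)
  case less
  have "((\<lambda>u::real. 0) has_real_derivative 2 * max 0 u) (at u)"
    using less by (simp add: max_def)
  then show ?thesis
    by (rule has_field_derivative_transform_within_open[where S = "{..<0}"]) (use less in auto)
next
  case greater
  have "((\<lambda>u::real. u\<^sup>2) has_real_derivative 2 * max 0 u) (at u)"
    using greater by (auto intro!: derivative_eq_intros)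
  then show ?thesis
    by (rule has_field_derivative_transform_within_open[where S = "{0<..}"]) (use greater in auto)
next
  case equal
  have "((\<lambda>h::real. max 0 h) \<longlongrightarrow> 0) (at 0)" by (auto intro!: tendsto_eq_intros)
  then have "((\<lambda>h::real. ((max 0 (0 + h))\<^sup>2 - (max 0 0)\<^sup>2) / h) \<longlongrightarrow> 0) (at 0)"
    by (rule Lim_transform_eventually)
      (auto simp: eventually_at_filter max_def power2_eq_square)
  then show ?thesis using equal by (simp add: DERIV_def)
qed

lemma GDERIV_sum:
  assumes "\<And>k. k \<in> K \<Longrightarrow> GDERIV (f k) x :> g k"
  shows "GDERIV (\<lambda>x. \<Sum>k\<in>K. f k x) x :> (\<Sum>k\<in>K. g k)"
  using assms unfolding gderiv_def
  by (auto simp: inner_sum_right intro!: has_derivative_sum)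

lemma GDERIV_global_min_eq_0:
  assumes "GDERIV f x :> D" "\<And>y. f x \<le> f y"
  shows "D = 0"
proof -
  have "(\<lambda>h. h \<bullet> D) = (\<lambda>h. 0)"
    using differential_zero_maxmin[of x UNIV f "\<lambda>h. h \<bullet> D"] assms unfolding gderiv_def by auto
  then have "D \<bullet> D = 0" by metis
  then show ?thesis by simp
qed

lemma GDERIV_imp_continuous_on:
  assumes "\<And>x. GDERIV f x :> g x"
  shows "continuous_on S f"
  using assms unfolding gderiv_def
  by (intro has_derivative_continuous_on) (blast intro: has_derivative_at_withinI)

text \<open>Two successive extractions: compactness of \<open>C\<close> for the points, then a
  further subsequence for the finitely many bounded coordinates of \<open>\<mu>\<close>.\<close>

lemma convergent_subsequence_pair:
  fixes y :: "nat \<Rightarrow> 'a::heine_borel" and \<mu> :: "nat \<Rightarrow> 'k \<Rightarrow> real"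
  assumes "\<And>m. y m \<in> C" "compact C" "finite B" "\<And>m k. k \<in> B \<Longrightarrow> \<bar>\<mu> m k\<bar> \<le> R"
  shows "\<exists>x\<in>C. \<exists>\<nu> \<phi>. strict_mono \<phi> \<and> (y \<circ> \<phi>) \<longlonglongrightarrow> x \<and>
    (\<forall>k\<in>B. (\<lambda>m. \<mu> (\<phi> m) k) \<longlonglongrightarrow> \<nu> k)"
proof -
  obtain x \<phi>1 where x: "x \<in> C" "strict_mono \<phi>1" "(y \<circ> \<phi>1) \<longlonglongrightarrow> x"
    using assms(1,2) unfolding compact_def by blast
  have "\<exists>\<nu> \<phi>2. strict_mono \<phi>2 \<and>
      (\<forall>e>0. eventually (\<lambda>m. \<forall>k\<in>B. dist (\<mu> (\<phi>1 (\<phi>2 m)) k) (\<nu> k) < e) sequentially)"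
    using compact_lemma_general[of B "\<lambda>\<nu> k. \<nu> k" "\<mu> \<circ> \<phi>1" "\<lambda>\<nu>. \<nu>"] assms(3,4)
    by (fastforce simp: bounded_iff)
  then obtain \<nu> \<phi>2 where \<phi>2: "strict_mono (\<phi>2 :: nat \<Rightarrow> nat)"
    "\<And>e. e > 0 \<Longrightarrow> eventually (\<lambda>m. \<forall>k\<in>B. dist (\<mu> (\<phi>1 (\<phi>2 m)) k) (\<nu> k) < e) sequentially"
    by blast
  have "strict_mono (\<phi>1 \<circ> \<phi>2)" using x(2) \<phi>2(1) by (rule strict_mono_o)
  moreover have "(y \<circ> (\<phi>1 \<circ> \<phi>2)) \<longlonglongrightarrow> x"
    using LIMSEQ_subseq_LIMSEQ[OF x(3) \<phi>2(1)] by (simp add: o_assoc)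
  moreover have "(\<lambda>m. \<mu> ((\<phi>1 \<circ> \<phi>2) m) k) \<longlonglongrightarrow> \<nu> k" if "k \<in> B" for k
    unfolding tendsto_iff using that by (auto intro: eventually_mono[OF \<phi>2(2)])
  ultimately show ?thesis using x(1) by blast
qed

text \<open>The penalized function \<open>G\<close> agrees with \<open>f\<close> at the feasible
  point \<open>p\<close> and is at least \<open>f\<close> everywhere. Outside \<open>C\<close> it
  therefore exceeds \<open>G p\<close>, so its minimizer over \<open>C\<close> is a global one and
  has zero gradient even on the boundary of \<open>C\<close>.\<close>

lemma penalty_stationary_point:
  fixes f :: "real^'n \<Rightarrow> real" and q :: "'k \<Rightarrow> real^'n \<Rightarrow> real"
  assumes f: "\<And>x. GDERIV f x :> gf x" and q: "\<And>k x. k \<in> I \<union> E \<Longrightarrow> GDERIV (q k) x :> g k x"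
    and C: "compact C" "p \<in> C" "p \<in> qcqp_feasible I E q" "\<And>y. y \<notin> C \<Longrightarrow> f p < f y"
    and \<rho>: "\<rho> \<ge> 0"
    and \<psi>: "\<psi> = (\<lambda>k u. if k \<in> E then u else max 0 u)"
  obtains y where "y \<in> C" "gf y + (\<Sum>k\<in>I \<union> E. (2 * \<rho> * \<psi> k (q k y)) *\<^sub>R g k y) = 0"
proof -
  define G where "G y = f y + (\<Sum>k\<in>I\<union>E. \<rho> * (\<psi> k (q k y))\<^sup>2)" for y
  have D\<psi>: "((\<lambda>u. \<rho> * (\<psi> k u)\<^sup>2) has_real_derivative 2 * \<rho> * \<psi> k u) (at u)" for k u
    using DERIV_cmult[OF DERIV_max_0_power2, of \<rho> u] unfolding \<psi>
    by (cases "k \<in> E") (auto intro!: derivative_eq_intros simp: mult_ac)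
  have DG: "GDERIV G y :> gf y + (\<Sum>k\<in>I\<union>E. (2 * \<rho> * \<psi> k (q k y)) *\<^sub>R g k y)" for y
    unfolding G_def using D\<psi> q
    by (intro GDERIV_add f GDERIV_sum GDERIV_DERIV_compose)
  have "continuous_on C G" using DG by (rule GDERIV_imp_continuous_on)
  then obtain y where y: "y \<in> C" "\<And>z. z \<in> C \<Longrightarrow> G y \<le> G z"
    using continuous_attains_inf[of C G] C(1,2) by blast
  have Gp: "G p = f p" using C(3) by (auto simp: G_def \<psi> qcqp_feasible_def intro!: sum.neutral)
  have Gf: "f z \<le> G z" for z using \<rho> by (auto simp: G_def intro!: sum_nonneg)
  have "G y \<le> G z" for z
    using y(2)[of z] y(2)[OF C(2)] C(4)[of z] Gf[of z] Gp by (cases "z \<in> C") auto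
  then show ?thesis using that[OF y(1)] GDERIV_global_min_eq_0[OF DG] by blast
qed

text \<open>Minimise \<open>f\<close> plus \<open>\<rho>\<close> times the squared constraint violation and let \<open>\<rho> \<rightarrow> \<infinity>\<close>: the uniform
  independence of the gradients bounds the multipliers \<open>2 \<rho> \<psi> k (q k y)\<close> read off the stationarity
  condition, which at once makes the limit point feasible and gives limiting multipliers.\<close>

lemma lagrange_multipliers:
  fixes f :: "real^'n \<Rightarrow> real" and q :: "'k \<Rightarrow> real^'n \<Rightarrow> real"
  assumes fin: "finite I" "finite E" and disj: "I \<inter> E = {}"
    and f: "\<And>x. GDERIV f x :> gf x" and q: "\<And>k x. k \<in> I \<union> E \<Longrightarrow> GDERIV (q k) x :> g k x"
    and contf: "continuous_on UNIV gf"
    and contg: "\<And>k. k \<in> I \<union> E \<Longrightarrow> continuous_on UNIV (g k)"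
    and C: "compact C" "p \<in> C" "p \<in> qcqp_feasible I E q" "\<And>y. y \<notin> C \<Longrightarrow> f p < f y"
    and B: "E \<subseteq> B" "B \<subseteq> I \<union> E" "\<And>k y. k \<in> I - B \<Longrightarrow> y \<in> C \<Longrightarrow> q k y < 0"
    and \<tau>: "\<tau> > 0" "\<And>y \<nu>. y \<in> C \<Longrightarrow> \<tau> * L2_set \<nu> B \<le> norm (\<Sum>k\<in>B. \<nu> k *\<^sub>R g k y)"
  shows "\<exists>x\<in>C \<inter> qcqp_feasible I E q. \<exists>\<nu>. gf x + (\<Sum>k\<in>B. \<nu> k *\<^sub>R g k x) = 0 \<and>
    (\<forall>k\<in>I \<inter> B. 0 \<le> \<nu> k \<and> \<nu> k * q k x = 0)"
proof -
  \<comment> \<open>The residual of a constraint: the value itself for an equality, its positive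
    part for an inequality. Feasibility means that all residuals vanish.\<close>
  define \<psi> where "\<psi> = (\<lambda>k (u::real). if k \<in> E then u else max 0 u)"
  have finB: "finite B" using fin B(2) finite_subset by blast
  have cont_q: "continuous_on UNIV (q k)" if "k \<in> I \<union> E" for k
    using q[OF that] by (rule GDERIV_imp_continuous_on)
  have cont_\<psi>: "isCont (\<psi> k) u" for k u
    unfolding \<psi>_def by (cases "k \<in> E") (auto intro!: continuous_intros)
  have "\<exists>y. \<forall>m. y m \<in> C \<and>
      gf (y m) + (\<Sum>k\<in>I \<union> E. (2 * real (Suc m) * \<psi> k (q k (y m))) *\<^sub>R g k (y m)) = 0"
    (is "\<exists>y. \<forall>m. ?P m (y m)")
  proof (rule choice, rule allI)
    fix m
    show "\<exists>y. ?P m y"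
    proof (rule penalty_stationary_point[OF f q C _ \<psi>_def, of "real (Suc m)"])
    qed auto
  qed
  then obtain y where yC: "\<And>m. y m \<in> C" and y_stat: "\<And>m. gf (y m) +
      (\<Sum>k\<in>I \<union> E. (2 * real (Suc m) * \<psi> k (q k (y m))) *\<^sub>R g k (y m)) = 0" by blast
  define \<mu> where "\<mu> m k = 2 * real (Suc m) * \<psi> k (q k (y m))" for m k
  \<comment> \<open>Constraints outside \<open>B\<close> are strictly satisfied on all of
    \<open>C\<close>, so they contribute no penalty and the stationarity condition involves only
    \<open>B\<close>.\<close>
  have off_B: "\<psi> k (q k (y m)) = 0" if "k \<in> I \<union> E - B" for m k
    using that B(1) B(3)[of k "y m"] yC[of m] by (auto simp: \<psi>_def)
  have stat: "gf (y m) + (\<Sum>k\<in>B. \<mu> m k *\<^sub>R g k (y m)) = 0" for m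
  proof -
    have "(\<Sum>k\<in>B. \<mu> m k *\<^sub>R g k (y m)) = (\<Sum>k\<in>I\<union>E. \<mu> m k *\<^sub>R g k (y m))"
      using off_B fin B(2) by (intro sum.mono_neutral_left) (auto simp: \<mu>_def)
    then show ?thesis using y_stat[of m] by (simp add: \<mu>_def)
  qed
  have "bounded (gf ` C)"
    using compact_continuous_image[of C gf] contf C(1) compact_imp_bounded
      continuous_on_subset by blast
  then obtain R where R: "\<And>y. y \<in> C \<Longrightarrow> norm (gf y) \<le> R" by (auto simp: bounded_iff)
  have \<mu>_bound: "\<bar>\<mu> m k\<bar> \<le> R / \<tau>" if "k \<in> B" for m k
  proof -
    have "\<tau> * L2_set (\<mu> m) B \<le> norm (\<Sum>k\<in>B. \<mu> m k *\<^sub>R g k (y m))" using \<tau>(2) yC by blast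
    also have "\<dots> = norm (gf (y m))" using stat[of m] by (metis add_eq_0_iff norm_minus_cancel)
    also have "\<dots> \<le> R" using R yC by blast
    finally have "L2_set (\<mu> m) B \<le> R / \<tau>" using \<tau>(1) by (simp add: field_simps)
    moreover have "\<bar>\<mu> m k\<bar> \<le> L2_set (\<lambda>k. \<bar>\<mu> m k\<bar>) B"
      using finB that by (intro member_le_L2_set) auto
    ultimately show ?thesis by (simp add: L2_set_def)
  qed
  obtain x \<nu> \<phi> where x: "x \<in> C" and \<phi>: "strict_mono \<phi>" and y_lim: "(y \<circ> \<phi>) \<longlonglongrightarrow> x"
    and \<mu>_lim': "\<forall>k\<in>B. (\<lambda>m. \<mu> (\<phi> m) k) \<longlonglongrightarrow> \<nu> k"
    using convergent_subsequence_pair[of y C B \<mu> "R / \<tau>"] yC C(1) finB \<mu>_bound by auto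
  have \<mu>_lim: "(\<lambda>m. \<mu> (\<phi> m) k) \<longlonglongrightarrow> \<nu> k" if "k \<in> B" for k
    using \<mu>_lim' that by blast
  have lim: "(\<lambda>m. h (y (\<phi> m))) \<longlonglongrightarrow> h x" if "continuous_on UNIV h" for h :: "real^'n \<Rightarrow> 'b::t2_space"
    using continuous_on_tendsto_compose[OF that y_lim] by (simp add: o_def)
  have q_lim: "(\<lambda>m. q k (y (\<phi> m))) \<longlonglongrightarrow> q k x" if "k \<in> I \<union> E" for k
    using lim[OF cont_q[OF that]] .
  have \<psi>_lim: "(\<lambda>m. \<psi> k (q k (y (\<phi> m)))) \<longlonglongrightarrow> \<psi> k (q k x)" if "k \<in> I \<union> E" for k
    using isCont_tendsto_compose[OF cont_\<psi> q_lim[OF that]] .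
  have \<psi>_zero: "\<psi> k (q k x) = 0" if k: "k \<in> I \<union> E" for k
  proof (cases "k \<in> B")
    case True
    \<comment> \<open>The residual is the multiplier divided by twice the penalty weight; the
      multipliers converge while the weights tend to infinity.\<close>
    have "(\<lambda>m. \<mu> (\<phi> m) k * (1 / (2 * real (Suc (\<phi> m))))) \<longlonglongrightarrow> \<nu> k * 0"
    proof (rule tendsto_mult[OF \<mu>_lim[OF True]])
      have "(\<lambda>m. 1 / (2 * real (Suc m))) \<longlonglongrightarrow> 0"
        using tendsto_mult[OF tendsto_const[of "1/2"] LIMSEQ_inverse_real_of_nat]
        by (simp add: field_simps)
      from LIMSEQ_subseq_LIMSEQ[OF this \<phi>]
      show "(\<lambda>m. 1 / (2 * real (Suc (\<phi> m)))) \<longlonglongrightarrow> 0" by (simp add: o_def)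
    qed
    moreover have "\<mu> (\<phi> m) k * (1 / (2 * real (Suc (\<phi> m)))) = \<psi> k (q k (y (\<phi> m)))" for m
      by (simp add: \<mu>_def del: of_nat_Suc)
    ultimately show ?thesis using \<psi>_lim[OF k] LIMSEQ_unique by fastforce
  next
    case False
    then show ?thesis using off_B k \<psi>_lim[OF k] by (simp add: LIMSEQ_const_iff)
  qed
  show ?thesis
  proof (intro bexI[of _ x] exI[of _ \<nu>] conjI ballI IntI)
    show "x \<in> qcqp_feasible I E q"
    proof -
      have "q k x \<le> 0" if "k \<in> I" for k
        using \<psi>_zero[of k] that by (auto simp: \<psi>_def split: if_splits)
      moreover have "q k x = 0" if "k \<in> E" for k
        using \<psi>_zero[of k] that by (auto simp: \<psi>_def)
      ultimately show ?thesis by (simp add: qcqp_feasible_def)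
    qed
    have "(\<lambda>m. gf (y (\<phi> m)) + (\<Sum>k\<in>B. \<mu> (\<phi> m) k *\<^sub>R g k (y (\<phi> m))))
        \<longlonglongrightarrow> gf x + (\<Sum>k\<in>B. \<nu> k *\<^sub>R g k x)"
      using B(2) contg contf
      by (intro tendsto_add tendsto_sum tendsto_scaleR \<mu>_lim lim) auto
    then show "gf x + (\<Sum>k\<in>B. \<nu> k *\<^sub>R g k x) = 0"
      by (simp add: stat LIMSEQ_const_iff)
    fix k assume k: "k \<in> I \<inter> B"
    then have kE: "k \<notin> E" using disj by blast
    show "0 \<le> \<nu> k"
      using \<mu>_lim[of k] k kE by (intro LIMSEQ_le_const[of _ "\<nu> k"]) (auto simp: \<mu>_def \<psi>_def)
    \<comment> \<open>Where the residual of an inequality differs from \<open>q k\<close>, its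
      multiplier is zero. So the products have the limits \<open>\<nu> k * q k x\<close> and
      \<open>\<nu> k * 0\<close> at once, which is complementary slackness.\<close>
    have \<mu>_q: "\<mu> m k * \<psi> k (q k (y m)) = \<mu> m k * q k (y m)" for m
      using kE by (auto simp: \<mu>_def \<psi>_def max_def)
    have "(\<lambda>m. \<mu> (\<phi> m) k * \<psi> k (q k (y (\<phi> m)))) \<longlonglongrightarrow> \<nu> k * q k x"
      unfolding \<mu>_q by (rule tendsto_mult[OF \<mu>_lim q_lim]) (use k in auto)
    moreover have "(\<lambda>m. \<mu> (\<phi> m) k * \<psi> k (q k (y (\<phi> m)))) \<longlonglongrightarrow> \<nu> k * 0"
      using tendsto_mult[OF \<mu>_lim[of k] \<psi>_lim[of k]] k \<psi>_zero[of k] by simp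
    ultimately show "\<nu> k * q k x = 0" using LIMSEQ_unique by fastforce
  qed (rule x)
qed

section \<open>The Lagrangian of the penalized program\<close>

lemma outer_in_psd_cone: "outer x x \<in> psd_cone r"
proof -
  have "psd_principal S (outer x x)" for S
  proof -
    have "(\<Sum>i\<in>S. \<Sum>j\<in>S. v i * outer x x $ i $ j * v j) = (\<Sum>i\<in>S. v i * x$i)\<^sup>2" for v
      by (simp add: outer_def power2_eq_square sum_product mult_ac)
    then show ?thesis by (simp add: psd_principal_def)
  qed
  then show ?thesis
    by (simp add: psd_cone_def sym_mat_def transpose_def outer_def mult.commute)
qed

lemma trace_outer: "trace (outer x x) = (norm x)\<^sup>2"
  unfolding power2_norm_eq_inner by (simp add: trace_def outer_def inner_vec_def)

lemma quad_expand:
  assumes "sym_mat M"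
  shows "quad M v \<alpha> x = quad M v \<alpha> y + (x - y) \<bullet> (2 *\<^sub>R (M *v y + v)) + (x - y) \<bullet> (M *v (x - y))"
  using sym_mat_form_commute[OF assms, of x y]
  by (simp add: quad_def matrix_vector_mult_diff_distrib inner_diff_left inner_diff_right
      inner_add_right inner_commute[of v] algebra_simps)

lemma lifted_quad_eq_quad: "lifted_quad M v \<alpha> x X = M \<bullet> (X - outer x x) + quad M v \<alpha> x"
  by (simp add: lifted_quad_def quad_def inner_diff_right inner_outer)

lemma lifted_quad_outer: "lifted_quad M v \<alpha> x (outer x x) = quad M v \<alpha> x"
  by (simp add: lifted_quad_eq_quad)

lemma sym_mat_add: "sym_mat M \<Longrightarrow> sym_mat M' \<Longrightarrow> sym_mat (M + M')"
  by (simp add: sym_mat_def transpose_def vec_eq_iff)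

lemma sym_mat_scaleR: "sym_mat M \<Longrightarrow> sym_mat (a *\<^sub>R M)"
  by (simp add: sym_mat_def transpose_def vec_eq_iff)

lemma sym_mat_mat_1: "sym_mat (mat 1)"
  by (simp add: sym_mat_def transpose_mat)

lemma sym_mat_sum: "(\<And>k. k \<in> K \<Longrightarrow> sym_mat (M k)) \<Longrightarrow> sym_mat (\<Sum>k\<in>K. M k)"
  by (simp add: sym_mat_def transpose_def vec_eq_iff)

lemma matrix_vector_sum_left:
  fixes M :: "'k \<Rightarrow> real^'n^'m"
  shows "(\<Sum>k\<in>K. M k) *v x = (\<Sum>k\<in>K. M k *v x)"
  by (induction K rule: infinite_finite_induct)
    (simp_all add: matrix_vector_mult_add_rdistrib)

text \<open>Stationarity makes \<open>x\<close> a critical point of the Lagrangian, whose quadratic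
  part \<open>Z\<close> satisfies \<open>\<kappa> * trace U \<le> Z \<bullet> U\<close> on the cone.
  The explicit gap serves twice: it gives optimality and, for \<open>\<kappa> > 0\<close>, also
  uniqueness and the rank-one form.\<close>

lemma penalized_sdp_gap:
  fixes A0 :: "real^'n^'n" and A :: "'k \<Rightarrow> real^'n^'n"
  assumes fin: "finite I" "finite E" and disj: "I \<inter> E = {}"
    and sym: "sym_mat A0" "\<And>k. k \<in> I \<union> E \<Longrightarrow> sym_mat (A k)"
    and q: "\<And>k. q k = quad (A k) (b k) (c k)" and qb: "\<And>k. qb k = lifted_quad (A k) (b k) (c k)"
    and r: "2 \<le> r" "r \<le> CARD('n)"
    and stat: "A0 *v x + b0 + \<eta> *\<^sub>R (x - xh) + (\<Sum>k\<in>I \<union> E. \<nu> k *\<^sub>R (A k *v x + b k)) = 0"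
    and \<nu>: "\<And>k. k \<in> I \<Longrightarrow> 0 \<le> \<nu> k" "\<And>k. k \<in> I \<union> E \<Longrightarrow> \<nu> k * q k x = 0"
    and feas: "(y, Y) \<in> psdp_feasible r I E qb"
    and \<kappa>: "\<kappa> = \<eta> - real ((CARD('n) - 1) choose (r - 1)) * spectral_norm (A0 + (\<Sum>k\<in>I \<union> E. \<nu> k *\<^sub>R A k))"
      "0 \<le> \<kappa>"
  shows "psdp_objective (lifted_quad A0 b0 c0) xh \<eta> (x, outer x x)
      + \<kappa> * (norm (Y - outer y y) + (norm (y - x))\<^sup>2)
    \<le> psdp_objective (lifted_quad A0 b0 c0) xh \<eta> (y, Y)"
proof -
  let ?obj = "psdp_objective (lifted_quad A0 b0 c0) xh \<eta>"
  let ?H = "A0 + (\<Sum>k\<in>I \<union> E. \<nu> k *\<^sub>R A k)"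
  define Z where "Z = ?H + \<eta> *\<^sub>R mat 1"
  \<comment> \<open>Together \<open>Z\<close>, \<open>w\<close> and \<open>\<beta>\<close> are the
    coefficients of the Lagrangian, which is thus a single lifted quadratic.\<close>
  define w where "w = b0 - \<eta> *\<^sub>R xh + (\<Sum>k\<in>I \<union> E. \<nu> k *\<^sub>R b k)"
  define \<beta> where "\<beta> = c0 + \<eta> * (xh \<bullet> xh) + (\<Sum>k\<in>I \<union> E. \<nu> k * c k)"
  have L: "lifted_quad Z w \<beta> u U = ?obj (u, U) + (\<Sum>k\<in>I \<union> E. \<nu> k * qb k u U)" for u U
  proof -
    have "(\<Sum>k\<in>I \<union> E. \<nu> k * qb k u U) = (\<Sum>k\<in>I \<union> E. \<nu> k * (A k \<bullet> U))
        + 2 * (\<Sum>k\<in>I \<union> E. \<nu> k * (b k \<bullet> u)) + (\<Sum>k\<in>I \<union> E. \<nu> k * c k)"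
      by (simp add: qb lifted_quad_def sum.distrib sum_distrib_left algebra_simps)
    then show ?thesis
      by (simp add: lifted_quad_def psdp_objective_def Z_def w_def \<beta>_def inner_add_left
          inner_diff_left inner_sum_left mat_1_inner algebra_simps)
  qed
  have Z_pos: "\<kappa> * trace U \<le> Z \<bullet> U" if "U \<in> psd_cone r" for U
    using psd_cone_inner_ge[OF that r, of ?H]
    by (simp add: Z_def \<kappa>(1) inner_add_left mat_1_inner algebra_simps)
  have Zsym: "sym_mat Z"
    unfolding Z_def using sym by (intro sym_mat_add sym_mat_sum sym_mat_scaleR sym_mat_mat_1) auto
  have Zx: "Z *v x + w = 0"
    using stat by (simp add: Z_def w_def matrix_vector_mult_add_rdistrib matrix_vector_sum_left
        scaleR_add_right sum.distrib algebra_simps flip: scaleR_matrix_vector_assoc)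
  have Y: "Y - outer y y \<in> psd_cone r" using feas by (simp add: psdp_feasible_def)
  have sum_x: "(\<Sum>k\<in>I \<union> E. \<nu> k * qb k x (outer x x)) = 0"
    using \<nu>(2) by (intro sum.neutral) (simp only: qb lifted_quad_outer flip: q, blast)
  have "?obj (x, outer x x) = lifted_quad Z w \<beta> x (outer x x)"
    unfolding L using sum_x by simp
  also have "\<dots> = quad Z w \<beta> x" by (rule lifted_quad_outer)
  finally have obj_x: "?obj (x, outer x x) = quad Z w \<beta> x" .
  have "(\<Sum>k\<in>I \<union> E. \<nu> k * qb k y Y) \<le> 0"
    using feas \<nu>(1) by (intro sum_nonpos) (auto simp: psdp_feasible_def mult_nonneg_nonpos)
  then have "lifted_quad Z w \<beta> y Y \<le> ?obj (y, Y)" by (simp add: L)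
  moreover have "lifted_quad Z w \<beta> y Y = Z \<bullet> (Y - outer y y) + quad Z w \<beta> x + Z \<bullet> outer (y - x) (y - x)"
    using quad_expand[OF Zsym, of w \<beta> y x] by (simp add: lifted_quad_eq_quad Zx inner_outer)
  moreover have "\<kappa> * norm (Y - outer y y) \<le> Z \<bullet> (Y - outer y y)"
    using mult_left_mono[OF norm_psd_cone_le_trace[OF Y r] \<kappa>(2)] Z_pos[OF Y] by linarith
  \<comment> \<open>The rank-one matrix of \<open>y - x\<close> lies in the cone too, so the same
    bound on \<open>Z\<close> handles the quadratic remainder.\<close>
  moreover have "\<kappa> * (norm (y - x))\<^sup>2 \<le> Z \<bullet> outer (y - x) (y - x)"
    using Z_pos[OF outer_in_psd_cone] by (simp add: trace_outer)
  ultimately show ?thesis by (simp add: obj_x algebra_simps)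
qed

section \<open>Homogeneous bounds from the sensitivity and the pencil norm\<close>

lemma spectral_norm_add_le: "spectral_norm (M + M') \<le> spectral_norm M + spectral_norm M'"
proof -
  have "(*v) (M + M') = (\<lambda>x. M *v x + M' *v x)"
    by (simp add: fun_eq_iff matrix_vector_mult_add_rdistrib)
  then show ?thesis
    using onorm_triangle[of "(*v) M" "(*v) M'"] by (simp add: spectral_norm_def)
qed

lemma spectral_norm_scaleR: "spectral_norm (a *\<^sub>R M) = \<bar>a\<bar> * spectral_norm M"
  using onorm_scaleR[of "(*v) M" a]
  by (simp add: spectral_norm_def scaleR_matrix_vector_assoc)

lemma spectral_norm_0: "spectral_norm 0 = 0"
  using spectral_norm_scaleR[of 0 0] by simp

lemma L2_set_eq_0_or_normalized:
  assumes "finite B"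
  obtains "L2_set \<nu> B = 0" "\<And>k. k \<in> B \<Longrightarrow> \<nu> k = 0"
  | l where "l = L2_set \<nu> B" "l > 0" "(\<Sum>k\<in>B. (\<nu> k / l)\<^sup>2) = 1"
proof (cases "L2_set \<nu> B = 0")
  case True
  then show ?thesis using that(1) assms by (simp add: L2_set_eq_0_iff)
next
  case False
  then have pos: "L2_set \<nu> B > 0" using L2_set_nonneg[of \<nu> B] by linarith
  have "(\<Sum>k\<in>B. (\<nu> k / L2_set \<nu> B)\<^sup>2) = (\<Sum>k\<in>B. (\<nu> k)\<^sup>2) / (L2_set \<nu> B)\<^sup>2"
    by (simp add: power_divide sum_divide_distrib)
  also have "(L2_set \<nu> B)\<^sup>2 = (\<Sum>k\<in>B. (\<nu> k)\<^sup>2)"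
    by (simp add: L2_set_def sum_nonneg)
  also have "(\<Sum>k\<in>B. (\<nu> k)\<^sup>2) / (\<Sum>k\<in>B. (\<nu> k)\<^sup>2) = 1"
    using pos by (auto simp: L2_set_def)
  finally show ?thesis using that(2)[of "L2_set \<nu> B"] pos by simp
qed

text \<open>Homogeneity extends the bound from the unit sphere to all \<open>\<nu>\<close>. A real
  \<open>\<sigma>\<close> below \<open>sigma_min\<close> also covers the value \<infinity>.\<close>

lemma sigma_min_lower_bound:
  assumes "finite B" "ennreal \<sigma> \<le> sigma_min B g"
  shows "\<sigma> * L2_set \<nu> B \<le> norm (\<Sum>k\<in>B. \<nu> k *\<^sub>R g k)"
  using assms(1)
proof (cases rule: L2_set_eq_0_or_normalized[where \<nu> = \<nu>])
  case 1
  then show ?thesis by simp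
next
  case (2 l)
  have "L2_set (\<lambda>k. \<nu> k / l) B = 1" using 2(3) by (simp add: L2_set_def)
  then have "sigma_min B g \<le> ennreal (norm (\<Sum>k\<in>B. (\<nu> k / l) *\<^sub>R g k))"
    unfolding sigma_min_def by (intro INF_lower) simp
  from order_trans[OF assms(2) this] have "\<sigma> \<le> norm (\<Sum>k\<in>B. (\<nu> k / l) *\<^sub>R g k)"
    by (simp only: ennreal_le_iff[OF norm_ge_zero])
  also have "(\<Sum>k\<in>B. (\<nu> k / l) *\<^sub>R g k) = (1 / l) *\<^sub>R (\<Sum>k\<in>B. \<nu> k *\<^sub>R g k)"
    by (simp add: scaleR_sum_right)
  finally show ?thesis using 2 by (simp add: field_simps)
qed

lemma pencil_norm_upper_bound:
  assumes fin: "finite I" "finite E" and disj: "I \<inter> E = {}"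
    and P: "pencil_norm I E A \<le> ennreal P" "0 \<le> P" and B: "B \<subseteq> I \<union> E"
  shows "spectral_norm (\<Sum>k\<in>B. \<nu> k *\<^sub>R A k) \<le> P * L2_set \<nu> B"
proof -
  have "finite B" using fin B finite_subset by blast
  then show ?thesis
  proof (cases rule: L2_set_eq_0_or_normalized[where \<nu> = \<nu>])
    case 1
    then show ?thesis by (simp add: spectral_norm_0)
  next
    case (2 l)
    \<comment> \<open>One function, extended by zero outside \<open>B\<close>, serves for both
      blocks of the pencil, because \<open>I\<close> and \<open>E\<close> are disjoint.\<close>
    define \<gamma> where "\<gamma> k = (if k \<in> B then \<nu> k / l else 0)" for k
    have "(L2_set \<gamma> I)\<^sup>2 + (L2_set \<gamma> E)\<^sup>2 = (\<Sum>k\<in>I. (\<gamma> k)\<^sup>2) + (\<Sum>k\<in>E. (\<gamma> k)\<^sup>2)"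
      by (simp add: L2_set_def sum_nonneg)
    also have "\<dots> = (\<Sum>k\<in>I \<union> E. (\<gamma> k)\<^sup>2)" using fin disj by (simp add: sum.union_disjoint)
    also have "\<dots> = (\<Sum>k\<in>B. (\<nu> k / l)\<^sup>2)"
      using fin B by (intro sum.mono_neutral_cong_right) (auto simp: \<gamma>_def)
    finally have "(L2_set \<gamma> I)\<^sup>2 + (L2_set \<gamma> E)\<^sup>2 = 1" using 2(3) by simp
    then have "ennreal (spectral_norm (pencil I E A \<gamma> \<gamma>)) \<le> pencil_norm I E A"
      unfolding pencil_norm_def by (intro SUP_upper2[of "(\<gamma>, \<gamma>)"]) auto
    then have "spectral_norm (pencil I E A \<gamma> \<gamma>) \<le> P"
      using P by (metis ennreal_le_iff order_trans)
    also have "pencil I E A \<gamma> \<gamma> = (\<Sum>k\<in>I \<union> E. \<gamma> k *\<^sub>R A k)"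
      using fin disj by (simp add: pencil_def sum.union_disjoint)
    also have "\<dots> = (\<Sum>k\<in>B. (\<nu> k / l) *\<^sub>R A k)"
      using fin B by (intro sum.mono_neutral_cong_right) (auto simp: \<gamma>_def)
    also have "\<dots> = (1 / l) *\<^sub>R (\<Sum>k\<in>B. \<nu> k *\<^sub>R A k)"
      by (simp add: scaleR_sum_right)
    finally show ?thesis using 2 by (simp add: spectral_norm_scaleR field_simps)
  qed
qed

text \<open>Covers the degenerate values \<open>s = \<infinity>\<close> and \<open>p = 0\<close> along with the regular case.\<close>

lemma ennreal_ratio_bound_real:
  assumes "ennreal d < inverse (1 + of_nat N) * (s / (2 * p))" "0 \<le> d"
  obtains \<sigma> P where "0 < \<sigma>" "0 \<le> P" "ennreal \<sigma> \<le> s" "p \<le> ennreal P" "2 * (1 + real N) * d * P < \<sigma>"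
proof -
  \<comment> \<open>A strict upper bound is nonzero, which excludes both
    \<open>p = \<infinity>\<close> and \<open>s = 0\<close>.\<close>
  have nz: "inverse (1 + of_nat N) * (s / (2 * p)) \<noteq> 0" using assms(1) by auto
  have "p \<noteq> top" using nz by (auto simp: ennreal_mult_top)
  then obtain P where P: "p = ennreal P" "0 \<le> P" by (cases p) auto
  show ?thesis
  proof (cases s)
    case top
    have "0 \<le> 2 * (1 + real N) * d * P" using P assms(2) by simp
    then show ?thesis
      by (intro that[of "2 * (1 + real N) * d * P + 1" P]) (use P top in auto)
  next
    case (real \<sigma>)
    have "\<sigma> \<noteq> 0" using nz real by auto
    then have \<sigma>: "\<sigma> > 0" using real by simp
    have "2 * (1 + real N) * d * P < \<sigma>"
    proof (cases "P = 0")
      case False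
      then have P0: "P > 0" using P by simp
      then have pos: "0 < 2 * (1 + real N) * P" by simp
      have e1: "(1 + of_nat N :: ennreal) = ennreal (1 + real N)"
        by (simp add: ennreal_of_nat_eq_real_of_nat flip: ennreal_1)
      have e2: "2 * p = ennreal (2 * P)"
        using P by (simp add: ennreal_mult)
      have "s / (2 * p) = ennreal (\<sigma> / (2 * P))"
        unfolding e2 real using P0 \<sigma> by (intro divide_ennreal) auto
      moreover have "inverse (1 + of_nat N) = ennreal (inverse (1 + real N))"
        unfolding e1 by (intro inverse_ennreal) simp
      moreover have "ennreal (inverse (1 + real N) * (\<sigma> / (2 * P))) =
          ennreal (inverse (1 + real N)) * ennreal (\<sigma> / (2 * P))"
        using P0 \<sigma> by (intro ennreal_mult) auto
      ultimately have "inverse (1 + of_nat N) * (s / (2 * p)) =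
          ennreal (inverse (1 + real N) * (\<sigma> / (2 * P)))"
        by (simp only:)
      then have "d < inverse (1 + real N) * (\<sigma> / (2 * P))"
        using assms by (simp add: ennreal_less_iff)
      also have "inverse u * (\<sigma> / (2 * P)) = \<sigma> / (2 * u * P)" for u
        by (cases "u = 0") (simp_all add: field_simps)
      finally have "d * (2 * (1 + real N) * P) < \<sigma>"
        by (simp only: pos_less_divide_eq[OF pos])
      then show ?thesis by (simp only: mult_ac)
    qed (use \<sigma> in simp)
    then show ?thesis using that[of \<sigma> P] \<sigma> P real by simp
  qed
qed

section \<open>Large penalties\<close>

text \<open>With \<open>t = norm (y - xh) > D\<close>, the penalty term gains at least
  \<open>\<eta> * c * t\<^sup>2\<close> over its value at \<open>p\<close>, while the quadratic
  drops by at most \<open>R * t\<^sup>2\<close>. Hence every \<open>\<eta>\<close> above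
  \<open>R / c\<close> works, uniformly in \<open>y\<close>.\<close>

lemma penalty_minimizers_near:
  fixes A0 :: "real^'n^'n"
  assumes sym: "sym_mat A0" and d: "norm (p - xh) < D"
  shows "\<exists>\<eta>1. \<forall>\<eta>\<ge>\<eta>1. \<forall>y. D < norm (y - xh) \<longrightarrow>
    quad A0 b0 c0 p + \<eta> * (norm (p - xh))\<^sup>2 < quad A0 b0 c0 y + \<eta> * (norm (y - xh))\<^sup>2"
proof -
  define d where "d = norm (p - xh)"
  define \<delta> where "\<delta> = quad A0 b0 c0 p - quad A0 b0 c0 xh"
  define g where "g = norm (2 *\<^sub>R (A0 *v xh + b0))"
  define a where "a = spectral_norm A0"
  define c where "c = 1 - d\<^sup>2 / D\<^sup>2"
  define R where "R = \<bar>\<delta>\<bar> / D\<^sup>2 + g / D + a"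
  have d0: "0 \<le> d" "d < D" using d by (auto simp: d_def)
  have D0: "0 < D" using d0 by simp
  have c0: "c > 0" using d0 power_strict_mono[of d D 2] by (simp add: c_def field_simps)
  show ?thesis
  proof (intro exI allI impI)
    fix \<eta> y assume \<eta>: "R / c + 1 \<le> \<eta>" and y: "D < norm (y - xh)"
    define t where "t = norm (y - xh)"
    have t: "D < t" using y by (simp add: t_def)
    \<comment> \<open>Dividing by powers of \<open>D\<close> turns constant and linear terms into
      multiples of \<open>t\<^sup>2\<close>.\<close>
    have t1: "D\<^sup>2 \<le> t\<^sup>2" "D * t \<le> t\<^sup>2" 
      using t D0 by (auto simp: power2_eq_square intro: mult_mono)
    have "quad A0 b0 c0 xh - quad A0 b0 c0 y \<le> g * t + a * t\<^sup>2"
    proof -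
      have "\<bar>(y - xh) \<bullet> (2 *\<^sub>R (A0 *v xh + b0))\<bar> \<le> t * g"
        unfolding t_def g_def by (rule Cauchy_Schwarz_ineq2)
      moreover have "\<bar>(y - xh) \<bullet> (A0 *v (y - xh))\<bar> \<le> a * t\<^sup>2"
        unfolding t_def a_def by (rule abs_quadratic_form_le)
      ultimately show ?thesis
        using quad_expand[OF sym, of b0 c0 y xh] by (simp add: mult.commute abs_le_iff)
    qed
    then have "quad A0 b0 c0 p - quad A0 b0 c0 y \<le> \<bar>\<delta>\<bar> + g * t + a * t\<^sup>2"
      unfolding \<delta>_def by linarith
    also have "\<bar>\<delta>\<bar> \<le> \<bar>\<delta>\<bar> / D\<^sup>2 * t\<^sup>2"
      using mult_left_mono[OF t1(1), of "\<bar>\<delta>\<bar>"] D0 by (simp add: field_simps)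
    also have "g * t \<le> g / D * t\<^sup>2"
      using mult_left_mono[OF t1(2), of g] D0 by (simp add: field_simps g_def)
    finally have 1: "quad A0 b0 c0 p - quad A0 b0 c0 y \<le> R * t\<^sup>2"
      by (simp add: R_def algebra_simps)
    have t2: "t\<^sup>2 > 0" using t D0 by simp
    have "R < \<eta> * c" using \<eta> c0 by (simp add: field_simps)
    then have 2: "R * t\<^sup>2 < \<eta> * (c * t\<^sup>2)" using t2 by simp
    have "0 \<le> R" using D0 spectral_norm_nonneg[of A0] by (simp add: R_def g_def a_def)
    then have "0 \<le> R / c" using c0 by simp
    then have "0 \<le> \<eta>" using \<eta> by linarith
    moreover have "c * t\<^sup>2 \<le> t\<^sup>2 - d\<^sup>2"
      using mult_left_mono[OF t1(1), of "d\<^sup>2"] D0 by (simp add: c_def field_simps)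
    ultimately have "\<eta> * (c * t\<^sup>2) \<le> \<eta> * (t\<^sup>2 - d\<^sup>2)" by (rule mult_left_mono[rotated])
    with 1 2 have "quad A0 b0 c0 p + \<eta> * d\<^sup>2 < quad A0 b0 c0 y + \<eta> * t\<^sup>2"
      by (simp add: algebra_simps)
    then show "quad A0 b0 c0 p + \<eta> * (norm (p - xh))\<^sup>2 < quad A0 b0 c0 y + \<eta> * (norm (y - xh))\<^sup>2"
      by (simp add: d_def t_def)
  qed
qed

text \<open>Finitely many strict inequalities, continuous in the radius, persist slightly to the
  right of \<open>d\<close>. The room between \<open>d\<close> and \<open>D\<close> is what confines
  minimizers for finite \<eta> to a ball.\<close>

lemma enlarge_radius:
  fixes h1 h2 h3 :: "'k \<Rightarrow> real"
  assumes "finite K" "\<And>k. k \<in> K \<Longrightarrow> h1 k + h2 k * d + h3 k * d\<^sup>2 < 0" "\<alpha> * d < \<sigma>"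
  obtains D where "d < D" "\<alpha> * D < \<sigma>" "\<And>k. k \<in> K \<Longrightarrow> h1 k + h2 k * D + h3 k * D\<^sup>2 < (0::real)"
proof -
  have "\<forall>\<^sub>F D in at_right d. h1 k + h2 k * D + h3 k * D\<^sup>2 < 0" if "k \<in> K" for k
  proof (rule order_tendstoD(2)[OF _ assms(2)[OF that]])
    show "((\<lambda>D. h1 k + h2 k * D + h3 k * D\<^sup>2) \<longlongrightarrow> h1 k + h2 k * d + h3 k * d\<^sup>2) (at_right d)"
      by (intro tendsto_intros)
  qed
  then have "\<forall>\<^sub>F D in at_right d. \<forall>k\<in>K. h1 k + h2 k * D + h3 k * D\<^sup>2 < 0"
    using assms(1) by (simp add: eventually_ball_finite)
  moreover have "\<forall>\<^sub>F D in at_right d. \<alpha> * D < \<sigma>"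
    by (rule order_tendstoD(2)[OF _ assms(3)]) (intro tendsto_intros)
  moreover have "\<forall>\<^sub>F D in at_right d. d < D" by (rule eventually_at_right_less)
  ultimately have "\<forall>\<^sub>F D in at_right d. d < D \<and> \<alpha> * D < \<sigma> \<and> (\<forall>k\<in>K. h1 k + h2 k * D + h3 k * D\<^sup>2 < 0)"
    by (intro eventually_conj)
  then show ?thesis using that eventually_happens'[OF trivial_limit_at_right_real] by blast
qed

text \<open>The expression that decides quasi-binding is the second-order Taylor upper bound of the
  constraint on the ball, which is exact up to norm estimates since the Hessian is constant.\<close>

lemma quad_less_0_on_cball:
  fixes M :: "real^'n^'n"
  assumes sym: "sym_mat M" and y: "y \<in> cball xh D"
    and neg: "quad M v \<alpha> xh + norm (gradient (quad M v \<alpha>) xh) * D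
      + 1/2 * spectral_norm (hessian (quad M v \<alpha>) xh) * D\<^sup>2 < 0"
  shows "quad M v \<alpha> y < 0"
proof -
  let ?g = "2 *\<^sub>R (M *v xh + v)"
  have yD: "norm (y - xh) \<le> D" using y by (simp add: dist_norm norm_minus_commute)
  have "(y - xh) \<bullet> ?g \<le> norm (y - xh) * norm ?g" by (rule norm_cauchy_schwarz)
  also have "\<dots> \<le> D * norm ?g" using yD by (intro mult_right_mono) auto
  finally have 1: "(y - xh) \<bullet> ?g \<le> norm ?g * D" by (simp add: mult.commute)
  have "(y - xh) \<bullet> (M *v (y - xh)) \<le> spectral_norm M * (norm (y - xh))\<^sup>2"
    using abs_quadratic_form_le[of "y - xh" M] by linarith
  also have "\<dots> \<le> spectral_norm M * D\<^sup>2"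
    using yD by (intro mult_left_mono power_mono spectral_norm_nonneg) auto
  finally show ?thesis
    using neg quad_expand[OF sym, of v \<alpha> y xh] 1
    by (simp only: gradient_quad[OF sym] hessian_quad[OF sym] spectral_norm_scaleR)
qed

theorem theorem2:
  fixes I E :: "'k set"
    and A0 :: "real^'n^'n" and b0 :: "real^'n" and c0 :: real
    and A :: "'k \<Rightarrow> real^'n^'n" and b :: "'k \<Rightarrow> real^'n" and c :: "'k \<Rightarrow> real"
    and q :: "'k \<Rightarrow> real^'n \<Rightarrow> real" and qb :: "'k \<Rightarrow> real^'n \<Rightarrow> real^'n^'n \<Rightarrow> real"
    and r :: nat and xh :: "real^'n"
  assumes "finite I" and "finite E" and "I \<inter> E = {}"
    and "sym_mat A0" and "\<And>k. k \<in> I \<union> E \<Longrightarrow> sym_mat (A k)"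
    and "\<And>k. q k = quad (A k) (b k) (c k)"
    and "\<And>k. qb k = lifted_quad (A k) (b k) (c k)"
    and "2 \<le> r" and "r \<le> CARD('n)"
    and "qcqp_feasible I E q \<noteq> {}"
    and "GLICQ I E q xh"
    and "ennreal (infdist xh (qcqp_feasible I E q))
           < inverse (1 + of_nat ((CARD('n) - 1) choose (r - 1)))
               * (sensitivity I E q xh / (2 * pencil_norm I E A))"
  shows "\<exists>\<eta>0. \<forall>\<eta>\<ge>\<eta>0. 0 < \<eta> \<longrightarrow>
           (\<exists>!z. psdp_optimal r I E (lifted_quad A0 b0 c0) qb xh \<eta> z) \<and>
           (\<forall>x X. psdp_optimal r I E (lifted_quad A0 b0 c0) qb xh \<eta> (x, X) \<longrightarrow>
              X = outer x x \<and> x \<in> qcqp_feasible I E q)"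
proof -
  note fin = assms(1,2) and disj = assms(3) and symA0 = assms(4) and symA = assms(5)
    and q = assms(6) and qb = assms(7) and r = assms(8,9)
  define F where "F = qcqp_feasible I E q"
  define d where "d = infdist xh F"
  define B where "B = quasi_binding I E q xh"
  define N where "N = ((CARD('n) - 1) choose (r - 1))"
  define g where "g k y = 2 *\<^sub>R (A k *v y + b k)" for k y
  have grad_q: "GDERIV (q k) y :> g k y" if "k \<in> I \<union> E" for k y
    using GDERIV_quad[OF symA[OF that]] by (simp add: q g_def)
  have gradient_q: "gradient (q k) y = g k y" if "k \<in> I \<union> E" for k y
    using grad_q[OF that] by (rule gradient_eqI)
  have B: "E \<subseteq> B" "B \<subseteq> I \<union> E"
    by (auto simp: B_def quasi_binding_def Let_def)
  have finB: "finite B" using B fin finite_subset by blast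

  \<comment> \<open>Real constants from the distance hypothesis\<close>
  have d0: "0 \<le> d" by (simp add: d_def infdist_nonneg)
  obtain \<sigma> P where \<sigma>: "0 < \<sigma>" "ennreal \<sigma> \<le> sensitivity I E q xh"
    and P: "0 \<le> P" "pencil_norm I E A \<le> ennreal P" and \<sigma>P: "2 * (1 + real N) * d * P < \<sigma>"
    using ennreal_ratio_bound_real[OF assms(12) infdist_nonneg] by (metis N_def d_def F_def)
  have "sensitivity I E q xh = sigma_min B (\<lambda>k. g k xh)"
    using assms(11) B(2) gradient_q unfolding sensitivity_def sigma_min_def B_def[symmetric]
    by (auto intro!: INF_cong arg_cong[where f = norm] sum.cong simp: subset_iff)
  then have sens: "\<sigma> * L2_set \<nu> B \<le> norm (\<Sum>k\<in>B. \<nu> k *\<^sub>R g k xh)" for \<nu>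
    using sigma_min_lower_bound[OF finB] \<sigma>(2) by metis
  have pen: "spectral_norm (\<Sum>k\<in>B. \<nu> k *\<^sub>R A k) \<le> P * L2_set \<nu> B" for \<nu>
    using pencil_norm_upper_bound[OF fin disj P(2,1) B(2)] .

  \<comment> \<open>A radius slightly larger than the distance\<close>
  have "q k xh + norm (gradient (q k) xh) * d + (1/2 * spectral_norm (hessian (q k) xh)) * d\<^sup>2 < 0"
    if "k \<in> I - B" for k
    using that by (auto simp: B_def quasi_binding_def Let_def d_def F_def)
  moreover have "2 * (1 + real N) * P * d < \<sigma>" using \<sigma>P by (simp add: mult_ac)
  ultimately obtain D where D: "d < D" "2 * (1 + real N) * P * D < \<sigma>"
    and negD: "\<And>k. k \<in> I - B \<Longrightarrow>
      q k xh + norm (gradient (q k) xh) * D + (1/2 * spectral_norm (hessian (q k) xh)) * D\<^sup>2 < 0"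
    using enlarge_radius[of "I - B" "\<lambda>k. q k xh" "\<lambda>k. norm (gradient (q k) xh)" d
        "\<lambda>k. 1/2 * spectral_norm (hessian (q k) xh)"] fin by (metis finite_Diff)
  have D0: "D > 0" using D d0 by simp
  have neg: "q k y < 0" if "k \<in> I - B" "y \<in> cball xh D" for k y
    using quad_less_0_on_cball[OF symA that(2)] negD[OF that(1)] that(1) by (auto simp: q)

  \<comment> \<open>Uniform independence of the gradients on the ball\<close>
  define \<tau> where "\<tau> = \<sigma> - 2 * P * D"
  have "0 \<le> 2 * real N * P * D" using P(1) D0 by simp
  \<comment> \<open>The factor \<open>1 + N\<close> of the hypothesis splits here: the 1 pays for
    the loss \<open>2 * P * D\<close> in \<open>\<tau>\<close>, and the \<open>N\<close> remains for
    the cone estimate.\<close>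
  moreover have \<tau>N: "2 * real N * P * D < \<tau>" using D(2) by (simp add: \<tau>_def algebra_simps)
  ultimately have \<tau>0: "\<tau> > 0" by linarith
  \<comment> \<open>Gradients are affine, so moving from \<open>xh\<close> to \<open>y\<close>
    changes their combination by exactly \<open>2 *\<^sub>R (?S *v (y - xh))\<close>, which the
    pencil norm controls.\<close>
  have indep: "\<tau> * L2_set \<nu> B \<le> norm (\<Sum>k\<in>B. \<nu> k *\<^sub>R g k y)" if "y \<in> cball xh D" for y \<nu>
  proof -
    let ?S = "\<Sum>k\<in>B. \<nu> k *\<^sub>R A k"
    have yD: "norm (y - xh) \<le> D" using that by (simp add: dist_norm norm_minus_commute)
    have eq: "(\<Sum>k\<in>B. \<nu> k *\<^sub>R g k y) = (\<Sum>k\<in>B. \<nu> k *\<^sub>R g k xh) + 2 *\<^sub>R (?S *v (y - xh))"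
      by (simp add: matrix_vector_sum_left scaleR_sum_right g_def matrix_vector_mult_diff_distrib
          algebra_simps flip: scaleR_matrix_vector_assoc sum.distrib sum_subtractf)
    have "norm (?S *v (y - xh)) \<le> spectral_norm ?S * norm (y - xh)"
      by (rule norm_matrix_vector_le_spectral)
    also have "\<dots> \<le> (P * L2_set \<nu> B) * D"
      using pen yD P(1) by (intro mult_mono) (auto simp: L2_set_nonneg)
    finally have "norm (2 *\<^sub>R (?S *v (y - xh))) \<le> 2 * P * D * L2_set \<nu> B" by (simp add: mult_ac)
    then show ?thesis
      using sens[of \<nu>] norm_diff_ineq[of "\<Sum>k\<in>B. \<nu> k *\<^sub>R g k xh" "2 *\<^sub>R (?S *v (y - xh))"]
      unfolding eq \<tau>_def by (simp add: left_diff_distrib)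
  qed

  \<comment> \<open>A nearest feasible point and the localization threshold\<close>
  have "closed F"
  proof -
    have "F = (\<Inter>k\<in>I. {x. q k x \<le> 0}) \<inter> (\<Inter>k\<in>E. {x. q k x = 0})"
      by (auto simp: F_def qcqp_feasible_def)
    moreover have "continuous_on UNIV (q k)" if "k \<in> I \<union> E" for k
      using grad_q[OF that] by (rule GDERIV_imp_continuous_on)
    ultimately show ?thesis
      by (auto intro!: closed_Int closed_INT closed_Collect_le closed_Collect_eq continuous_on_const)
  qed
  then obtain p where p: "p \<in> F" "norm (p - xh) = d"
    using infdist_attains_inf[of F xh] assms(10) unfolding d_def F_def
    by (metis dist_norm norm_minus_commute)
  obtain \<eta>1 where \<eta>1: "\<And>\<eta> y. \<eta>1 \<le> \<eta> \<Longrightarrow> D < norm (y - xh) \<Longrightarrow>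
      quad A0 b0 c0 p + \<eta> * (norm (p - xh))\<^sup>2 < quad A0 b0 c0 y + \<eta> * (norm (y - xh))\<^sup>2"
    using penalty_minimizers_near[OF symA0, of p xh D b0 c0] p(2) D(1) by blast

  \<comment> \<open>Optimality and uniqueness for large penalties\<close>
  define a where "a = spectral_norm A0"
  define M where "M = 2 * (a * (norm xh + D) + norm b0)"
  \<comment> \<open>This solves \<open>N * (a + P * (2 * \<eta> * D + M) / \<tau>) < \<eta>\<close>
    for \<eta>, where \<open>M\<close> bounds the part of \<open>gf\<close> on the ball that is
    independent of \<eta>. The denominator is positive by \<open>\<tau>N\<close>, and the added 1
    makes the inequality strict.\<close>
  define \<eta>2 where "\<eta>2 = (real N * a * \<tau> + real N * P * M) / (\<tau> - 2 * real N * P * D) + 1"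

  have main: "\<exists>x\<in>F. psdp_optimal r I E (lifted_quad A0 b0 c0) qb xh \<eta> (x, outer x x) \<and>
      (\<forall>z. psdp_optimal r I E (lifted_quad A0 b0 c0) qb xh \<eta> z \<longrightarrow> z = (x, outer x x))"
    if \<eta>: "\<eta>1 \<le> \<eta>" "\<eta>2 \<le> \<eta>" "0 < \<eta>" for \<eta>
  proof -
    define f where "f = quad (A0 + \<eta> *\<^sub>R mat 1) (b0 - \<eta> *\<^sub>R xh) (c0 + \<eta> * (xh \<bullet> xh))"
    define gf where "gf y = 2 *\<^sub>R (A0 *v y + b0 + \<eta> *\<^sub>R (y - xh))" for y
    have Zy: "(A0 + \<eta> *\<^sub>R mat 1) *v y = A0 *v y + \<eta> *\<^sub>R y" for y
      by (simp add: matrix_vector_mult_add_rdistrib flip: scaleR_matrix_vector_assoc)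
    have dist2: "(norm (y - xh))\<^sup>2 = y \<bullet> y - 2 * (xh \<bullet> y) + xh \<bullet> xh" for y
      by (simp add: power2_norm_eq_inner inner_diff_left inner_diff_right inner_commute[of y xh])
    have f_eq: "f y = quad A0 b0 c0 y + \<eta> * (norm (y - xh))\<^sup>2" for y
      unfolding f_def quad_def Zy dist2
      by (simp add: inner_add_right inner_diff_left) (simp add: algebra_simps)
    have Df: "GDERIV f y :> gf y" for y
    proof -
      have "sym_mat (A0 + \<eta> *\<^sub>R mat 1)"
        by (intro sym_mat_add sym_mat_scaleR sym_mat_mat_1 symA0)
      moreover have "gf y = 2 *\<^sub>R ((A0 + \<eta> *\<^sub>R mat 1) *v y + (b0 - \<eta> *\<^sub>R xh))"
        unfolding Zy by (simp add: gf_def algebra_simps)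
      ultimately show ?thesis unfolding f_def by (simp only: GDERIV_quad)
    qed
    have cont_mv: "continuous_on UNIV (\<lambda>y. H *v y)" for H :: "real^'n^'n"
      by (rule linear_continuous_on) (rule matrix_vector_mul_bounded_linear)
    have contf: "continuous_on UNIV gf" and contg: "continuous_on UNIV (g k)" for k
      unfolding gf_def g_def by (intro continuous_intros cont_mv)+
    have pC: "p \<in> cball xh D" using p(2) D(1) by (simp add: dist_norm norm_minus_commute)
    have out: "f p < f y" if "y \<notin> cball xh D" for y
      using \<eta>1[OF \<eta>(1), of y] that by (simp add: f_eq dist_norm norm_minus_commute)
    have "\<exists>x\<in>cball xh D \<inter> F. \<exists>\<nu>. gf x + (\<Sum>k\<in>B. \<nu> k *\<^sub>R g k x) = 0 \<and>
        (\<forall>k\<in>I \<inter> B. 0 \<le> \<nu> k \<and> \<nu> k * q k x = 0)"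
      unfolding F_def
      by (rule lagrange_multipliers[OF fin disj Df grad_q contf contg compact_cball pC
            p(1)[unfolded F_def] out B neg \<tau>0 indep])
    then obtain x \<nu> where xC: "x \<in> cball xh D" and xF: "x \<in> F"
      and stat: "gf x + (\<Sum>k\<in>B. \<nu> k *\<^sub>R g k x) = 0"
      and \<nu>_nn: "\<And>k. k \<in> I \<inter> B \<Longrightarrow> 0 \<le> \<nu> k" and \<nu>_cs: "\<And>k. k \<in> I \<inter> B \<Longrightarrow> \<nu> k * q k x = 0"
      by blast
    have xD: "norm (x - xh) \<le> D" using xC by (simp add: dist_norm norm_minus_commute)
    define l where "l = L2_set \<nu> B"
    have l0: "0 \<le> l" by (simp add: l_def L2_set_nonneg)
    \<comment> \<open>By stationarity the combination of constraint gradients has the norm of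
      \<open>gf x\<close>, so \<open>indep\<close> becomes an upper bound on the
      multipliers.\<close>
    have l_bound: "\<tau> * l \<le> 2 * \<eta> * D + M"
    proof -
      have "\<tau> * l \<le> norm (gf x)"
        using indep[OF xC, of \<nu>] stat unfolding l_def by (metis add_eq_0_iff norm_minus_cancel)
      also have "\<dots> = 2 * norm (A0 *v x + b0 + \<eta> *\<^sub>R (x - xh))" by (simp add: gf_def)
      also have "norm (A0 *v x + b0 + \<eta> *\<^sub>R (x - xh)) \<le> norm (A0 *v x) + norm b0 + \<eta> * norm (x - xh)"
        using norm_triangle_ineq[of "A0 *v x + b0" "\<eta> *\<^sub>R (x - xh)"]
          norm_triangle_ineq[of "A0 *v x" b0] \<eta>(3) by simp
      also have "\<eta> * norm (x - xh) \<le> \<eta> * D" using xD \<eta>(3) by simp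
      also have "norm (A0 *v x) \<le> a * norm x" unfolding a_def by (rule norm_matrix_vector_le_spectral)
      also have "a * norm x \<le> a * (norm xh + D)"
        using norm_triangle_ineq[of xh "x - xh"] xD spectral_norm_nonneg[of A0]
        by (intro mult_left_mono) (auto simp: a_def)
      finally show ?thesis by (simp add: M_def algebra_simps)
    qed
    \<comment> \<open>The Lagrangian sums over all constraints, so multipliers outside
      \<open>B\<close> are set to zero.\<close>
    define \<nu>' where "\<nu>' k = (if k \<in> B then \<nu> k else 0)" for k
    have ext: "(\<Sum>k\<in>I\<union>E. \<nu>' k *\<^sub>R h k) = (\<Sum>k\<in>B. \<nu> k *\<^sub>R h k)" for h :: "'k \<Rightarrow> 'b::real_vector"
      using fin B(2) by (intro sum.mono_neutral_cong_right) (auto simp: \<nu>'_def)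
    define \<kappa> where "\<kappa> = \<eta> - real N * spectral_norm (A0 + (\<Sum>k\<in>I \<union> E. \<nu>' k *\<^sub>R A k))"
    have \<kappa>: "\<kappa> > 0"
    proof -
      have "spectral_norm (A0 + (\<Sum>k\<in>I \<union> E. \<nu>' k *\<^sub>R A k)) \<le> a + P * l"
        using spectral_norm_add_le[of A0 "\<Sum>k\<in>B. \<nu> k *\<^sub>R A k"] pen[of \<nu>]
        unfolding ext a_def l_def by linarith
      then have 1: "real N * spectral_norm (A0 + (\<Sum>k\<in>I \<union> E. \<nu>' k *\<^sub>R A k)) \<le> real N * (a + P * l)"
        by (intro mult_left_mono) auto
      have "\<tau> * (real N * (a + P * l)) = real N * a * \<tau> + real N * P * (\<tau> * l)"
        by (simp add: algebra_simps)
      also have "\<dots> \<le> real N * a * \<tau> + real N * P * (2 * \<eta> * D + M)"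
        using l_bound P(1) by (intro add_left_mono mult_left_mono) auto
      also have "\<dots> < \<tau> * \<eta>"
      proof -
        have "(real N * a * \<tau> + real N * P * M) / (\<tau> - 2 * real N * P * D) < \<eta>"
          using \<eta>(2) by (simp add: \<eta>2_def)
        then have "real N * a * \<tau> + real N * P * M < \<eta> * (\<tau> - 2 * real N * P * D)"
          using \<tau>N by (simp add: pos_divide_less_eq)
        then show ?thesis by (simp add: algebra_simps)
      qed
      finally have "real N * (a + P * l) < \<eta>" using \<tau>0 by simp
      then show ?thesis using 1 by (simp add: \<kappa>_def)
    qed
    have stat': "A0 *v x + b0 + \<eta> *\<^sub>R (x - xh) + (\<Sum>k\<in>I \<union> E. \<nu>' k *\<^sub>R (A k *v x + b k)) = 0"
      (is "?s = 0")
    proof -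
      have "2 *\<^sub>R ?s = 0"
        unfolding ext using stat by (simp add: gf_def g_def scaleR_add_right scaleR_sum_right mult_ac)
      then show ?thesis unfolding scaleR_eq_0_iff by simp
    qed
    have gap: "psdp_objective (lifted_quad A0 b0 c0) xh \<eta> (x, outer x x)
        + \<kappa> * (norm (Y - outer y y) + (norm (y - x))\<^sup>2)
      \<le> psdp_objective (lifted_quad A0 b0 c0) xh \<eta> (y, Y)"
      if "(y, Y) \<in> psdp_feasible r I E qb" for y Y
    proof (rule penalized_sdp_gap[OF fin disj symA0 symA q qb r _ _ _ that \<kappa>_def[unfolded N_def]])
      show "A0 *v x + b0 + \<eta> *\<^sub>R (x - xh) + (\<Sum>k\<in>I \<union> E. \<nu>' k *\<^sub>R (A k *v x + b k)) = 0"
        by (rule stat')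
      show "0 \<le> \<nu>' k" if "k \<in> I" for k using that \<nu>_nn by (simp add: \<nu>'_def)
      show "\<nu>' k * q k x = 0" if "k \<in> I \<union> E" for k
        using that \<nu>_cs[of k] xF by (auto simp: \<nu>'_def F_def qcqp_feasible_def)
    qed (use \<kappa> in auto)
    have feas: "(x, outer x x) \<in> psdp_feasible r I E qb"
    proof -
      have "sym_mat (outer x x)" using outer_in_psd_cone[of x r] by (simp add: psd_cone_def)
      moreover have "(0 :: real^'n^'n) \<in> psd_cone r"
        using outer_in_psd_cone[of 0 r] by (simp add: outer_def zero_vec_def)
      ultimately show ?thesis
        using xF by (simp add: psdp_feasible_def F_def qcqp_feasible_def qb q lifted_quad_outer)
    qed
    have "psdp_optimal r I E (lifted_quad A0 b0 c0) qb xh \<eta> (x, outer x x)"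
      unfolding psdp_optimal_def is_arg_min_def
    proof (intro conjI feas notI, elim exE conjE)
      fix z assume z: "z \<in> psdp_feasible r I E qb"
        and lt: "psdp_objective (lifted_quad A0 b0 c0) xh \<eta> z
          < psdp_objective (lifted_quad A0 b0 c0) xh \<eta> (x, outer x x)"
      obtain y Y where yY: "z = (y, Y)" by (cases z)
      have "0 \<le> \<kappa> * (norm (Y - outer y y) + (norm (y - x))\<^sup>2)" using \<kappa> by simp
      then show False using gap[of y Y] z lt unfolding yY by linarith
    qed
    moreover have "z = (x, outer x x)"
      if z: "psdp_optimal r I E (lifted_quad A0 b0 c0) qb xh \<eta> z" for z
    proof -
      obtain y Y where yY: "z = (y, Y)" by (cases z)
      have "psdp_objective (lifted_quad A0 b0 c0) xh \<eta> (y, Y)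
          \<le> psdp_objective (lifted_quad A0 b0 c0) xh \<eta> (x, outer x x)"
        using z feas unfolding yY psdp_optimal_def is_arg_min_def by (meson not_le)
      moreover have "(y, Y) \<in> psdp_feasible r I E qb"
        using z unfolding yY psdp_optimal_def is_arg_min_def by blast
      ultimately have "\<kappa> * (norm (Y - outer y y) + (norm (y - x))\<^sup>2) \<le> 0"
        using gap[of y Y] by linarith
      \<comment> \<open>Strict positivity of \<open>\<kappa>\<close> is essential: both nonnegative
        distances must vanish, so any optimal pair equals \<open>(x, outer x x)\<close>.\<close>
      then have "norm (Y - outer y y) + (norm (y - x))\<^sup>2 \<le> 0"
        using \<kappa> by (simp add: mult_le_0_iff)
      moreover have "0 \<le> norm (Y - outer y y)" "0 \<le> (norm (y - x))\<^sup>2" by simp_all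
      ultimately have "norm (Y - outer y y) = 0" "(norm (y - x))\<^sup>2 = 0" by linarith+
      then show ?thesis by (simp add: yY)
    qed
    ultimately show ?thesis using xF by blast
  qed
  show ?thesis
  proof (intro exI[of _ "max \<eta>1 \<eta>2"] allI impI)
    fix \<eta> assume "max \<eta>1 \<eta>2 \<le> \<eta>" "0 < \<eta>"
    then obtain x where "x \<in> F" "psdp_optimal r I E (lifted_quad A0 b0 c0) qb xh \<eta> (x, outer x x)"
      "\<And>z. psdp_optimal r I E (lifted_quad A0 b0 c0) qb xh \<eta> z \<Longrightarrow> z = (x, outer x x)"
      using main[of \<eta>] by auto
    then show "(\<exists>!z. psdp_optimal r I E (lifted_quad A0 b0 c0) qb xh \<eta> z) \<and>
        (\<forall>x X. psdp_optimal r I E (lifted_quad A0 b0 c0) qb xh \<eta> (x, X) \<longrightarrow>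
          X = outer x x \<and> x \<in> qcqp_feasible I E q)"
      unfolding F_def by blast
  qed
qed

end
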